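(* Let $(p_t)_{t\ge0}$ be a convolution semigroup of probability measures on $\mathbb{R}^d$ and let $L$ be the infinitesimal generator of the semigroup $P_tf(x)=\int_{\mathbb{R}^d}f(z+x)\,p_t(dz)$ on $(C_0(\mathbb{R}^d),\|\cdot\|_\infty)$. Let $A$ be a closed linear operator with domain $D(A)\subset C_0(\mathbb{R}^d)$ such that $C_c^\infty(\mathbb{R}^d)$ is a core of $A$. If for all $s\in\mathbb{R}$, $x\in\mathbb{R}^d$ and $\phi\in C_c^\infty(\mathbb{R}\times\mathbb{R}^d)$, $$\int_s^\infty\int_{\mathbb{R}^d}\Big[\partial_u\phi(u,x+z)+A\phi(u,x+z)\Big]\,p_{u-s}(dz)\,du=-\phi(s,x),$$ where $A\phi(u,\cdot)$ denotes $A$ applied to the function $\phi(u,\cdot)$, then $A=L$.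
   Context: $C_0(\mathbb{R}^d)$ is the Banach space of continuous functions vanishing at infinity with the sup norm; $(P_t)_{t\ge0}$ is a strongly continuous semigroup on it. A core of a closed operator $A$ is a subspace of $D(A)$ whose graph-norm closure is the graph of $A$. *)

theory Defs
  imports "HOL-Analysis.Analysis" "HOL-Probability.Probability"
begin

definition C0 :: "('a::real_normed_vector \<Rightarrow> real) \<Rightarrow> bool" where
  "C0 f \<longleftrightarrow> continuous_on UNIV f \<and> (f \<longlongrightarrow> 0) at_infinity"

definition pd :: "'a::euclidean_space \<Rightarrow> ('a \<Rightarrow> real) \<Rightarrow> ('a \<Rightarrow> real)" where
  "pd i f = (\<lambda>x. frechet_derivative f (at x) i)"

definition smooth :: "('a::euclidean_space \<Rightarrow> real) \<Rightarrow> bool" where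
  "smooth f \<longleftrightarrow> (\<forall>is. set is \<subseteq> Basis \<longrightarrow> (\<forall>x. foldr pd is f differentiable at x))"

definition test_fun :: "('a::euclidean_space \<Rightarrow> real) \<Rightarrow> bool" where
  "test_fun f \<longleftrightarrow> smooth f \<and> compact (closure {x. f x \<noteq> 0})"

definition conv_semigroup :: "(real \<Rightarrow> (real^'n) measure) \<Rightarrow> bool" where
  "conv_semigroup p \<longleftrightarrow>
     (\<forall>t\<ge>0. prob_space (p t) \<and> sets (p t) = sets borel) \<and>
     p 0 = return borel 0 \<and>
     (\<forall>s\<ge>0. \<forall>t\<ge>0. p (s + t) = convolution (p s) (p t)) \<and>
     (\<forall>f::real^'n \<Rightarrow> real. continuous_on UNIV f \<longrightarrow> bounded (range f) \<longrightarrow>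
        ((\<lambda>t. \<integral>z. f z \<partial>p t) \<longlongrightarrow> f 0) (at_right 0))"

definition Psg :: "(real \<Rightarrow> (real^'n) measure) \<Rightarrow> real \<Rightarrow> (real^'n \<Rightarrow> real) \<Rightarrow> real^'n \<Rightarrow> real" where
  "Psg p t f x = (\<integral>z. f (z + x) \<partial>p t)"

text \<open>Graph of the infinitesimal generator L on (C_0, sup norm):
  gen p f g means f \<in> D(L) and L f = g.\<close>
definition gen :: "(real \<Rightarrow> (real^'n) measure) \<Rightarrow> (real^'n \<Rightarrow> real) \<Rightarrow> (real^'n \<Rightarrow> real) \<Rightarrow> bool" where
  "gen p f g \<longleftrightarrow> C0 f \<and> C0 g \<and>
     uniform_limit UNIV (\<lambda>t x. (Psg p t f x - f x) / t) g (at_right 0)"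

definition lin_op :: "('a::real_normed_vector \<Rightarrow> real) set \<Rightarrow> (('a \<Rightarrow> real) \<Rightarrow> ('a \<Rightarrow> real)) \<Rightarrow> bool" where
  "lin_op D A \<longleftrightarrow> D \<subseteq> {f. C0 f} \<and> (\<forall>f\<in>D. C0 (A f)) \<and> (\<lambda>x. 0) \<in> D \<and>
     (\<forall>f\<in>D. \<forall>g\<in>D. (\<lambda>x. f x + g x) \<in> D \<and> A (\<lambda>x. f x + g x) = (\<lambda>x. A f x + A g x)) \<and>
     (\<forall>f\<in>D. \<forall>c. (\<lambda>x. c * f x) \<in> D \<and> A (\<lambda>x. c * f x) = (\<lambda>x. c * A f x))"

definition closed_op :: "('a::real_normed_vector \<Rightarrow> real) set \<Rightarrow> (('a \<Rightarrow> real) \<Rightarrow> ('a \<Rightarrow> real)) \<Rightarrow> bool" where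
  "closed_op D A \<longleftrightarrow> (\<forall>F f g. (\<forall>n. F n \<in> D) \<longrightarrow> uniform_limit UNIV F f sequentially \<longrightarrow>
      uniform_limit UNIV (\<lambda>n. A (F n)) g sequentially \<longrightarrow> f \<in> D \<and> A f = g)"

definition is_core :: "('a::real_normed_vector \<Rightarrow> real) set \<Rightarrow> ('a \<Rightarrow> real) set \<Rightarrow> (('a \<Rightarrow> real) \<Rightarrow> ('a \<Rightarrow> real)) \<Rightarrow> bool" where
  "is_core C D A \<longleftrightarrow> C \<subseteq> D \<and>
     (\<forall>f\<in>D. \<exists>F. (\<forall>n. F n \<in> C) \<and> uniform_limit UNIV F f sequentially \<and>
        uniform_limit UNIV (\<lambda>n. A (F n)) (A f) sequentially)"

end

theory Submission
  imports Defs
begin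

text \<open>
  Write \<open>P\<^sub>u\<close> for the semigroup and \<open>M\<^sub>s f = (1/s) \<integral>\<^sub>0\<^sup>s P\<^sub>u f du\<close>. Testing the hypothesis with products
  \<open>\<eta>(u) f(y)\<close> says that \<open>u \<mapsto> P\<^sub>u f(x)\<close> has the weak derivative \<open>P\<^sub>u (A f)(x)\<close>; hence
  \<open>(P\<^sub>s f - f)/s = M\<^sub>s (A f)\<close> for test functions and, by the core property, for all \<open>f\<close> in the domain of \<open>A\<close>.
  Strong continuity gives \<open>A \<subseteq> L\<close>.

  Conversely, if \<open>f\<close> is a test function, convolving it with
  \<open>p\<^sub>u\<close> restricted to a ball gives again a test function, on which \<open>A\<close> (being a restriction of \<open>L\<close>) commutes with
  the convolution. Letting the ball grow and using closedness, \<open>P\<^sub>u f\<close> lies in the domain and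
  \<open>A (P\<^sub>u f) = P\<^sub>u (A f)\<close>; Riemann sums give \<open>A (M\<^sub>s f) = M\<^sub>s (A f) = (P\<^sub>s f - f)/s\<close>. Since test functions are dense and
  \<open>f \<mapsto> M\<^sub>s f\<close>, \<open>f \<mapsto> (P\<^sub>s f - f)/s\<close> are bounded, \<open>A (M\<^sub>s f) = (P\<^sub>s f - f)/s\<close> holds for every \<open>f\<close> in \<open>C\<^sub>0\<close>. If \<open>f\<close> is in the
  domain of \<open>L\<close>, then \<open>s \<rightarrow> 0\<close> and closedness of \<open>A\<close> show that \<open>f\<close> is in the domain of \<open>A\<close>.
\<close>

section \<open>Smooth functions and functions vanishing at infinity\<close>

text \<open>Differentiability of order n + 1: level 0 already asks for \<open>f\<close>
  differentiable. Peeling off the derivative taken first, instead of quantifying over direction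
  lists as \<open>smooth\<close> does, permits induction on n with \<open>f\<close> generalised, so
  that the product and chain rules apply to the new functions they create.\<close>

primrec ndiff :: "nat \<Rightarrow> ('a::euclidean_space \<Rightarrow> real) \<Rightarrow> bool" where
  "ndiff 0 f \<longleftrightarrow> (\<forall>x. f differentiable at x)"
| "ndiff (Suc n) f \<longleftrightarrow> (\<forall>x. f differentiable at x) \<and> (\<forall>i\<in>Basis. ndiff n (pd i f))"

lemma ndiff_differentiable: "ndiff n f \<Longrightarrow> f differentiable at x"
  by (cases n) auto

lemma ndiff_iff_foldr:
  "ndiff n f \<longleftrightarrow> (\<forall>is. set is \<subseteq> Basis \<longrightarrow> length is \<le> n \<longrightarrow> (\<forall>x. foldr pd is f differentiable at x))"
proof (induction n arbitrary: f)
  case (Suc n)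
  have "(\<forall>is. set is \<subseteq> Basis \<longrightarrow> length is \<le> Suc n \<longrightarrow> (\<forall>x. foldr pd is f differentiable at x)) \<longleftrightarrow>
     (\<forall>x. f differentiable at x) \<and> (\<forall>i\<in>Basis. \<forall>is. set is \<subseteq> Basis \<longrightarrow> length is \<le> n \<longrightarrow>
        (\<forall>x. foldr pd is (pd i f) differentiable at x))" (is "?L \<longleftrightarrow> ?R")
  proof
    assume L: ?L
    show ?R
    proof (intro conjI ballI allI impI)
      fix x show "f differentiable at x" using L[rule_format, of "[]"] by simp
    next
      fix i :: 'a and "is" :: "'a list" and x assume "i \<in> Basis" "set is \<subseteq> Basis" "length is \<le> n"
      then show "foldr pd is (pd i f) differentiable at x"
        \<comment> \<open>\<open>foldr pd\<close> applies the last direction of the list first, so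
          the derivative taken first sits at the right end.\<close>
        using L[rule_format, of "is @ [i]"] by simp
    qed
  next
    assume R: ?R
    show ?L
    proof (intro allI impI)
      fix "is" :: "'a list" and x assume *: "set is \<subseteq> Basis" "length is \<le> Suc n"
      show "foldr pd is f differentiable at x"
        using R * by (cases "is" rule: rev_cases) auto
    qed
  qed
  with Suc show ?case by simp
qed simp

lemma smooth_iff_ndiff: "smooth f \<longleftrightarrow> (\<forall>n. ndiff n f)"
  unfolding smooth_def ndiff_iff_foldr by auto

lemma smooth_differentiable: "smooth f \<Longrightarrow> f differentiable at x"
  using ndiff_differentiable smooth_iff_ndiff by blast

lemma smooth_continuous: "smooth f \<Longrightarrow> continuous_on UNIV f"
  by (simp add: continuous_at_imp_continuous_on differentiable_imp_continuous_within smooth_differentiable)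

lemma smooth_pd: "smooth f \<Longrightarrow> i \<in> Basis \<Longrightarrow> smooth (pd i f)"
  unfolding smooth_iff_ndiff by (metis ndiff.simps(2))

lemma ndiff_mono: "ndiff (Suc n) f \<Longrightarrow> ndiff n f"
  by (induction n arbitrary: f) auto

lemma pd_eqI: "(f has_derivative f') (at x) \<Longrightarrow> pd i f x = f' i"
  unfolding pd_def by (metis frechet_derivative_at)

lemma has_derivative_frechet: "f differentiable at x \<Longrightarrow> (f has_derivative frechet_derivative f (at x)) (at x)"
  by (simp add: frechet_derivative_works)

lemma ndiff_const: "ndiff n (\<lambda>x. c)"
proof (induction n arbitrary: c)
  case (Suc n)
  have "pd i (\<lambda>x. c) = (\<lambda>x. 0)" for i :: 'a
    by (rule ext, rule pd_eqI) auto
  with Suc show ?case by simp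
qed simp

lemma ndiff_add:
  assumes "ndiff n f" "ndiff n g"
  shows "ndiff n (\<lambda>x. f x + g x)"
  using assms
proof (induction n arbitrary: f g)
  case (Suc n)
  have "pd i (\<lambda>x. f x + g x) = (\<lambda>x. pd i f x + pd i g x)" for i
    unfolding pd_def using Suc.prems by (auto intro!: ext pd_eqI[unfolded pd_def] derivative_intros has_derivative_frechet)
  with Suc show ?case by simp
qed simp

lemma ndiff_mult:
  assumes "ndiff n f" "ndiff n g"
  shows "ndiff n (\<lambda>x. f x * g x)"
  using assms
proof (induction n arbitrary: f g)
  case (Suc n)
  have "pd i (\<lambda>x. f x * g x) = (\<lambda>x. f x * pd i g x + pd i f x * g x)" for i
    using Suc.prems unfolding pd_def
    by (auto intro!: ext pd_eqI[unfolded pd_def] derivative_intros has_derivative_frechet)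
  \<comment> \<open>The product rule leaves one factor undifferentiated, so the factors themselves
    are needed at the lower order.\<close>
  moreover have "ndiff n f" "ndiff n g" using Suc.prems ndiff_mono by blast+
  ultimately show ?case using Suc by (simp add: ndiff_add)
qed simp

text \<open>By the chain rule the derivative is a composite of \<open>pd 1 h\<close> with the same
  \<open>g\<close>, times a derivative of \<open>g\<close>; hence the induction generalises
  \<open>h\<close> only.\<close>

lemma ndiff_compose_real:
  fixes h :: "real \<Rightarrow> real"
  assumes "ndiff n h" "ndiff n g"
  shows "ndiff n (\<lambda>x. h (g x))"
  using assms
proof (induction n arbitrary: h)
  case 0
  then show ?case
    by (simp add: differentiable_compose[of _ g])
next
  case (Suc n)
  have "pd i (\<lambda>x. h (g x)) = (\<lambda>x. pd 1 h (g x) * pd i g x)" for i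
  proof (rule ext)
    fix x
    have h: "(h has_derivative frechet_derivative h (at (g x))) (at (g x))"
      and g: "(g has_derivative frechet_derivative g (at x)) (at x)"
      using Suc.prems by (auto intro: has_derivative_frechet)
    have lin: "linear (frechet_derivative h (at (g x)))"
      using h has_derivative_linear by blast
    show "pd i (\<lambda>x. h (g x)) x = pd 1 h (g x) * pd i g x"
      using linear_cmul[OF lin, of "frechet_derivative g (at x) i" 1]
      by (simp add: pd_eqI[OF has_derivative_compose[OF g h]]) (simp add: pd_def)
  qed
  moreover have "ndiff n (\<lambda>x. pd 1 h (g x))"
    using Suc.prems by (intro Suc.IH[of "pd 1 h"] ndiff_mono[of n g]) auto
  ultimately show ?case
    using Suc.prems by (simp add: differentiable_compose[of _ g] ndiff_mult)
qed

text \<open>For such \<open>T\<close> a partial derivative of the composite is zero or a partial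
  derivative of \<open>f\<close> composed with \<open>T\<close>, so no linear combinations arise.
  The projections \<open>fst\<close> and \<open>snd\<close> are of this kind.\<close>

lemma ndiff_compose_linear:
  fixes T :: "'a::euclidean_space \<Rightarrow> 'b::euclidean_space"
  assumes T: "bounded_linear T" "\<And>i. i \<in> Basis \<Longrightarrow> T i \<in> Basis \<or> T i = 0" and "ndiff n f"
  shows "ndiff n (\<lambda>x. f (T x))"
proof -
  have diff: "(\<lambda>x. f (T x)) differentiable at x" if "\<And>x. f differentiable at x" for f x
    by (rule differentiable_compose[OF that bounded_linear_imp_differentiable[OF T(1)]])
  show ?thesis using assms(3)
  proof (induction n arbitrary: f)
    case 0
    then show ?case by (auto intro: diff)
  next
    case (Suc n)
    have pd: "pd i (\<lambda>x. f (T x)) = (\<lambda>x. pd (T i) f (T x))" for i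
    proof (rule ext)
      fix x
      have "((\<lambda>x. f (T x)) has_derivative (\<lambda>h. frechet_derivative f (at (T x)) (T h))) (at x)"
        using Suc.prems
        by (intro has_derivative_compose[OF bounded_linear_imp_has_derivative[OF T(1)] has_derivative_frechet]) auto
      from pd_eqI[OF this] show "pd i (\<lambda>x. f (T x)) x = pd (T i) f (T x)" by (simp add: pd_def)
    qed
    have "ndiff n (pd i (\<lambda>x. f (T x)))" if "i \<in> Basis" for i
    proof (cases "T i = 0")
      case True
      then have "pd i (\<lambda>x. f (T x)) = (\<lambda>x. 0)"
        using Suc.prems unfolding pd
        by (auto simp: pd_def intro!: ext linear_0 linear_frechet_derivative)
      then show ?thesis by (simp add: ndiff_const)
    next
      case False
      then show ?thesis unfolding pd using T(2)[OF that] Suc by auto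
    qed
    then show ?case
      using Suc.prems by (auto intro: diff)
  qed
qed

lemma ndiff_linear:
  assumes "bounded_linear f"
  shows "ndiff n f"
proof (cases n)
  case (Suc m)
  have "pd i f = (\<lambda>x. f i)" for i
    by (rule ext, rule pd_eqI) (rule bounded_linear_imp_has_derivative[OF assms])
  with Suc assms show ?thesis
    by (auto simp: ndiff_const intro: bounded_linear_imp_differentiable)
qed (auto simp: assms intro: bounded_linear_imp_differentiable)

lemma smooth_const: "smooth (\<lambda>x. c)"
  and smooth_add: "smooth f \<Longrightarrow> smooth g \<Longrightarrow> smooth (\<lambda>x. f x + g x)"
  and smooth_mult: "smooth f \<Longrightarrow> smooth g \<Longrightarrow> smooth (\<lambda>x. f x * g x)"
  and smooth_compose_real: "smooth h \<Longrightarrow> smooth f \<Longrightarrow> smooth (\<lambda>x. h (f x))"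
  and smooth_linear: "bounded_linear f \<Longrightarrow> smooth f"
  and smooth_compose_linear: "bounded_linear T \<Longrightarrow> (\<And>i. i \<in> Basis \<Longrightarrow> T i \<in> Basis \<or> T i = 0) \<Longrightarrow>
    smooth k \<Longrightarrow> smooth (\<lambda>x. k (T x))"
  by (auto simp: smooth_iff_ndiff ndiff_const ndiff_add ndiff_mult ndiff_compose_real ndiff_linear ndiff_compose_linear)

lemma smooth_sum: "(\<And>i. i \<in> I \<Longrightarrow> smooth (f i)) \<Longrightarrow> smooth (\<lambda>x. \<Sum>i\<in>I. f i x)"
  by (induction I rule: infinite_finite_induct) (auto simp: smooth_const smooth_add)

lemma smooth_inner_self: "smooth (\<lambda>x::'a::euclidean_space. x \<bullet> x)"
proof -
  have "smooth (\<lambda>x::'a. \<Sum>i\<in>Basis. (x \<bullet> i) * (x \<bullet> i))"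
    by (intro smooth_sum smooth_mult smooth_linear bounded_linear_inner_left)
  then show ?thesis by (simp add: euclidean_inner[symmetric])
qed

lemma pd_real: "(f has_real_derivative d) (at x) \<Longrightarrow> pd 1 f x = d"
  by (drule pd_eqI[of f _ x 1, OF has_field_derivative_imp_has_derivative]) simp

text \<open>Induction on the order works because the derivative may change its shape but stays in
  \<open>S\<close>. The family meant is that of all \<open>flat_exp q\<close>.\<close>

lemma smooth_realI:
  assumes "\<And>f. f \<in> S \<Longrightarrow> \<exists>g\<in>S. \<forall>x. (f has_real_derivative g x) (at x)" "f \<in> S"
  shows "smooth f"
proof -
  have "ndiff n f" for n using assms(2)
  proof (induction n arbitrary: f)
    case 0
    with assms(1)[OF 0] show ?case
      by (auto intro: differentiableI dest: has_field_derivative_imp_has_derivative)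
  next
    case (Suc n)
    obtain g where g: "g \<in> S" "\<And>x. (f has_real_derivative g x) (at x)"
      using assms(1)[OF Suc.prems] by blast
    have "pd 1 f = g" by (rule ext, rule pd_real, rule g)
    with Suc.IH[OF g(1)] g(2) show ?case
      by (auto intro: differentiableI dest: has_field_derivative_imp_has_derivative)
  qed
  then show ?thesis by (simp add: smooth_iff_ndiff)
qed

lemma smooth_real_antiderivative:
  assumes "\<And>x. (f has_real_derivative g x) (at x)" "smooth g"
  shows "smooth f"
proof -
  have "pd 1 f = g" by (rule ext, rule pd_real, rule assms)
  moreover have "f differentiable at x" for x
    using assms(1)[of x] by (auto intro: differentiableI dest: has_field_derivative_imp_has_derivative)
  ultimately have "ndiff n f" for n using assms(2)
    by (cases n) (auto simp: smooth_iff_ndiff)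
  then show ?thesis by (simp add: smooth_iff_ndiff)
qed

section \<open>A smooth bump supported in a ball\<close>

definition flat_exp :: "real poly \<Rightarrow> real \<Rightarrow> real" where
  "flat_exp q t = (if t > 0 then poly q (1 / t) * exp (- (1 / t)) else 0)"

lemma poly_exp_tendsto_0: "((\<lambda>x. poly q x * exp (- x)) \<longlongrightarrow> (0::real)) at_top"
proof -
  have "((\<lambda>x. \<Sum>i\<le>degree q. coeff q i * (x ^ i / exp x)) \<longlongrightarrow> (\<Sum>i\<le>degree q. coeff q i * 0)) at_top"
    by (intro tendsto_intros tendsto_power_div_exp_0)
  then show ?thesis
    by (simp add: poly_altdef sum_distrib_left exp_minus divide_inverse mult_ac)
qed

text \<open>With v = 1/t the operator d/dt is -v^2 d/dv, which sends q(v) exp(-v) to v^2 (q - q')(v)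
  exp(-v); \<open>[:0, 0, 1:]\<close> is v^2. At 0 both one-sided difference quotients tend to
  0.\<close>

lemma flat_exp_has_derivative:
  "(flat_exp q has_real_derivative flat_exp ([:0, 0, 1:] * (q - pderiv q)) t) (at t)"
proof -
  consider "t > 0" | "t < 0" | "t = 0" by linarith
  then show ?thesis
  proof cases
    case 1
    have "((\<lambda>t. poly q (1 / t) * exp (- (1 / t))) has_real_derivative
       flat_exp ([:0, 0, 1:] * (q - pderiv q)) t) (at t)"
      using 1 by (auto intro!: derivative_eq_intros simp: flat_exp_def field_simps power2_eq_square)
    moreover have "eventually (\<lambda>s. s \<in> {0<..}) (nhds t)"
      using 1 by (intro eventually_nhds_in_open) auto
    then have "eventually (\<lambda>s. flat_exp q s = poly q (1 / s) * exp (- (1 / s))) (nhds t)"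
      by eventually_elim (auto simp: flat_exp_def)
    ultimately show ?thesis by (subst DERIV_cong_ev) auto
  next
    case 2
    have "eventually (\<lambda>s. s \<in> {..<0}) (nhds t)"
      using 2 by (intro eventually_nhds_in_open) auto
    then have "eventually (\<lambda>s. flat_exp q s = 0) (nhds t)"
      by eventually_elim (auto simp: flat_exp_def)
    then show ?thesis using 2 by (subst DERIV_cong_ev[OF refl _ refl]) (auto simp: flat_exp_def)
  next
    case 3
    \<comment> \<open>The extra factor 1/h of the difference quotient is absorbed by passing from
      \<open>q\<close> to \<open>pCons 0 q\<close>.\<close>
    have "((\<lambda>h. poly (pCons 0 q) (inverse h) * exp (- inverse h)) \<longlongrightarrow> 0) (at_right 0)"
      by (rule filterlim_compose[OF poly_exp_tendsto_0 filterlim_inverse_at_top_right])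
    then have r: "((\<lambda>h. flat_exp q h / h) \<longlongrightarrow> 0) (at_right 0)"
      by (rule Lim_transform_eventually)
         (auto simp: flat_exp_def divide_inverse mult_ac eventually_at_right_less
           intro!: eventually_mono[OF eventually_at_right_less])
    have l: "((\<lambda>h. flat_exp q h / h) \<longlongrightarrow> 0) (at_left 0)"
      by (rule Lim_transform_eventually[OF tendsto_const])
         (auto simp: flat_exp_def eventually_at_left_field intro!: exI[of _ "-1"])
    show ?thesis using 3 filterlim_split_at[OF l r]
      by (simp add: DERIV_def flat_exp_def[of _ 0])
  qed
qed

lemma smooth_flat_exp: "smooth (flat_exp q)"
  by (rule smooth_realI[of "range flat_exp"]) (use flat_exp_has_derivative in blast)+

text \<open>The squared norm, unlike the norm, is smooth at the origin. For r > 0 the function is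
  positive exactly on the open ball of radius r; its integral is not normalised.\<close>

definition bump :: "real \<Rightarrow> 'a::euclidean_space \<Rightarrow> real" where
  "bump r x = flat_exp 1 (r\<^sup>2 - x \<bullet> x)"

lemma bump_nonneg: "bump r x \<ge> 0"
  by (simp add: bump_def flat_exp_def)

lemma bump_pos_iff:
  assumes "r > 0"
  shows "bump r x > 0 \<longleftrightarrow> norm x < r"
proof -
  have "bump r x > 0 \<longleftrightarrow> (norm x)\<^sup>2 < r\<^sup>2"
    by (simp add: bump_def flat_exp_def dot_square_norm)
  also have "\<dots> \<longleftrightarrow> norm x < r"
    using assms by (meson norm_ge_zero power_less_imp_less_base power_strict_mono less_imp_le zero_less_numeral)
  finally show ?thesis .
qed

lemma bump_eq_0: "r > 0 \<Longrightarrow> norm x \<ge> r \<Longrightarrow> bump r x = 0"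
  using bump_pos_iff[of r x] bump_nonneg[of r x] by auto

lemma smooth_bump: "smooth (bump r :: 'a::euclidean_space \<Rightarrow> real)"
proof -
  have "smooth (\<lambda>x::'a. r\<^sup>2 + (-1) * (x \<bullet> x))"
    by (intro smooth_add smooth_mult smooth_const smooth_inner_self)
  then have "smooth (\<lambda>x::'a. flat_exp 1 (r\<^sup>2 + (-1) * (x \<bullet> x)))"
    by (rule smooth_compose_real[OF smooth_flat_exp])
  then show ?thesis by (simp add: bump_def[abs_def])
qed

section \<open>Test functions and functions vanishing at infinity\<close>

lemma test_funI:
  assumes "smooth f" "\<And>x. norm x > R \<Longrightarrow> f x = 0"
  shows "test_fun f"
proof -
  have "bounded {x. f x \<noteq> 0}"
    using assms(2) by (intro bounded_subset[OF bounded_cball[of 0 R]]) (auto simp: not_less[symmetric])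
  then show ?thesis using assms(1) by (auto simp: test_fun_def compact_closure)
qed

lemma test_funE:
  assumes "test_fun f"
  obtains R where "R > 0" "smooth f" "\<And>x. norm x \<ge> R \<Longrightarrow> f x = 0"
proof -
  have "bounded {x. f x \<noteq> 0}" using assms by (auto simp: test_fun_def compact_closure)
  then obtain R where R: "R > 0" "\<And>x. f x \<noteq> 0 \<Longrightarrow> norm x \<le> R"
    unfolding bounded_pos by auto
  show thesis
  proof (rule that[of "R + 1"])
    show "f x = 0" if "norm x \<ge> R + 1" for x using R(2)[of x] that by linarith
  qed (use R assms in \<open>auto simp: test_fun_def\<close>)
qed

lemma test_fun_pd:
  assumes "test_fun f" "i \<in> Basis"
  shows "test_fun (pd i f)"
proof -
  obtain R where R: "smooth f" "\<And>x. norm x \<ge> R \<Longrightarrow> f x = 0"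
    using assms(1) test_funE by metis
  show ?thesis
  proof (rule test_funI[of _ R])
    show "smooth (pd i f)" using R assms(2) by (simp add: smooth_pd)
    fix x :: 'a assume "norm x > R"
    then have "(f has_derivative (\<lambda>h. 0)) (at x)"
      by (intro has_derivative_transform_within_open[OF has_derivative_const, where s = "- cball 0 R"])
         (auto simp: R)
    then show "pd i f x = 0" by (rule pd_eqI)
  qed
qed

lemma C0_compact_support:
  fixes f :: "'a::real_normed_vector \<Rightarrow> real"
  assumes "continuous_on UNIV f" "\<And>x. norm x \<ge> R \<Longrightarrow> f x = 0"
  shows "C0 f"
  unfolding C0_def using assms
  by (auto intro!: tendsto_eventually exI[of _ R] simp: eventually_at_infinity)

lemma test_fun_C0: "test_fun f \<Longrightarrow> C0 f"
  by (erule test_funE) (rule C0_compact_support, auto intro: smooth_continuous)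

lemma C0_bounded:
  fixes f :: "'a::euclidean_space \<Rightarrow> real"
  assumes "C0 f"
  obtains M where "M > 0" "\<And>x. \<bar>f x\<bar> \<le> M"
proof -
  have "eventually (\<lambda>x. dist (f x) 0 < 1) at_infinity"
    using assms unfolding C0_def by (blast intro: tendstoD zero_less_one)
  then obtain R where R: "\<And>x. norm x \<ge> R \<Longrightarrow> \<bar>f x\<bar> < 1"
    by (auto simp: eventually_at_infinity)
  have "bounded (f ` cball 0 R)"
    using assms by (intro compact_imp_bounded compact_continuous_image)
      (auto simp: C0_def intro: continuous_on_subset)
  then obtain B where B: "\<And>x. norm x \<le> R \<Longrightarrow> \<bar>f x\<bar> \<le> B"
    unfolding bounded_iff by (metis imageI mem_cball_0 real_norm_def)
  have "\<bar>f x\<bar> \<le> max 1 B" for x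
    using R[of x] B[of x] by (cases "norm x \<le> R") auto
  then show thesis by (intro that[of "max 1 B"]) auto
qed

lemma C0_uniformly_continuous:
  fixes f :: "'a::euclidean_space \<Rightarrow> real"
  assumes "C0 f"
  shows "uniformly_continuous_on UNIV f"
  unfolding uniformly_continuous_on_def
proof (intro allI impI)
  fix e :: real assume e: "e > 0"
  have "eventually (\<lambda>x. dist (f x) 0 < e / 2) at_infinity"
    using assms e unfolding C0_def by (blast intro: tendstoD half_gt_zero)
  then obtain R where R: "\<And>x. norm x \<ge> R \<Longrightarrow> \<bar>f x\<bar> < e / 2"
    by (auto simp: eventually_at_infinity)
  have "uniformly_continuous_on (cball 0 (R + 1)) f"
    using assms by (intro compact_uniformly_continuous) (auto simp: C0_def intro: continuous_on_subset)
  then obtain d where d: "d > 0"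
    "\<And>x y. norm x \<le> R + 1 \<Longrightarrow> norm y \<le> R + 1 \<Longrightarrow> dist y x < d \<Longrightarrow> dist (f y) (f x) < e"
    using e unfolding uniformly_continuous_on_def by force
  \<comment> \<open>Points at distance less than 1 lie either both in the ball of radius
    \<open>R + 1\<close> or both beyond radius \<open>R\<close>, where \<open>f\<close> is below e/2
    in absolute value.\<close>
  have "dist (f y) (f x) < e" if "dist y x < min d 1" for x y
  proof (cases "norm x \<le> R + 1 \<and> norm y \<le> R + 1")
    case True
    then show ?thesis using d that by auto
  next
    case False
    have "\<bar>norm y - norm x\<bar> < 1"
      using that norm_triangle_ineq3[of y x] by (simp add: dist_norm)
    then have "norm x \<ge> R" "norm y \<ge> R" using False by auto
    then have "\<bar>f x\<bar> < e / 2" "\<bar>f y\<bar> < e / 2" using R by auto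
    then show ?thesis by (simp add: dist_real_def)
  qed
  then show "\<exists>d>0. \<forall>x\<in>UNIV. \<forall>x'\<in>UNIV. dist x' x < d \<longrightarrow> dist (f x') (f x) < e"
    using d(1) by (intro exI[of _ "min d 1"]) auto
qed

section \<open>Smoothing by convolution\<close>

lemma frechet_derivative_eq_sum_pd:
  assumes "f differentiable at x"
  shows "frechet_derivative f (at x) h = (\<Sum>i\<in>Basis. (h \<bullet> i) * pd i f x)"
proof -
  have lin: "linear (frechet_derivative f (at x))" by (rule linear_frechet_derivative[OF assms])
  have "frechet_derivative f (at x) h = frechet_derivative f (at x) (\<Sum>i\<in>Basis. (h \<bullet> i) *\<^sub>R i)"
    by (simp add: euclidean_representation)
  also have "\<dots> = (\<Sum>i\<in>Basis. (h \<bullet> i) * pd i f x)"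
    by (simp add: linear_sum[OF lin] linear_scale[OF lin] pd_def)
  finally show ?thesis .
qed

text \<open>Mean value theorem along the segment, plus uniform continuity of the finitely many
  partial derivatives. The point is that \<open>d\<close> does not depend on \<open>y\<close>, so
  the remainder can be estimated under an integral.\<close>

lemma test_fun_uniform_linearization:
  fixes g :: "'a::euclidean_space \<Rightarrow> real"
  assumes "test_fun g" "e > 0"
  obtains d where "d > 0"
    "\<And>y h. norm h < d \<Longrightarrow> \<bar>g (y + h) - g y - (\<Sum>i\<in>Basis. (h \<bullet> i) * pd i g y)\<bar> \<le> e * norm h"
proof -
  define e' where "e' = e / DIM('a)"
  have e': "e' > 0" using assms(2) by (simp add: e'_def)
  have "\<exists>d>0. \<forall>x y. dist y x < d \<longrightarrow> dist (pd i g y) (pd i g x) < e'" if "i \<in> Basis" for i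
    using C0_uniformly_continuous[OF test_fun_C0[OF test_fun_pd[OF assms(1) that]]] e'
    unfolding uniformly_continuous_on_def by auto
  then obtain \<delta> where \<delta>: "\<And>i. i \<in> Basis \<Longrightarrow> \<delta> i > 0"
    "\<And>i x y. i \<in> Basis \<Longrightarrow> dist y x < \<delta> i \<Longrightarrow> dist (pd i g y) (pd i g x) < e'"
    by metis
  define d where "d = Min (\<delta> ` Basis)"
  have d: "d > 0" "\<And>i. i \<in> Basis \<Longrightarrow> d \<le> \<delta> i"
    using \<delta>(1) by (auto simp: d_def)
  have diff: "g differentiable at y" for y
    using assms(1) by (auto simp: test_fun_def intro: smooth_differentiable)
  have "\<bar>g (y + h) - g y - (\<Sum>i\<in>Basis. (h \<bullet> i) * pd i g y)\<bar> \<le> e * norm h" if h: "norm h < d" for y h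
  proof -
    have "((\<lambda>t. g (y + t *\<^sub>R h)) has_derivative (\<lambda>s. frechet_derivative g (at (y + t *\<^sub>R h)) (s *\<^sub>R h)))
      (at t within {0..1})" for t :: real
      by (rule has_derivative_compose[where g = g, OF _ has_derivative_frechet[OF diff]])
         (auto intro!: derivative_eq_intros)
    then obtain t :: real where t: "t \<in> {0<..<1}"
      "g (y + 1 *\<^sub>R h) - g (y + 0 *\<^sub>R h) = frechet_derivative g (at (y + t *\<^sub>R h)) ((1 - 0) *\<^sub>R h)"
      using mvt_simple[of "0::real" 1 "\<lambda>t. g (y + t *\<^sub>R h)"
        "\<lambda>t s. frechet_derivative g (at (y + t *\<^sub>R h)) (s *\<^sub>R h)"] by auto
    have "g (y + h) - g y - (\<Sum>i\<in>Basis. (h \<bullet> i) * pd i g y) =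
      (\<Sum>i\<in>Basis. (h \<bullet> i) * (pd i g (y + t *\<^sub>R h) - pd i g y))"
      using t(2) by (simp add: frechet_derivative_eq_sum_pd[OF diff] right_diff_distrib sum_subtractf)
    also have "\<bar>\<dots>\<bar> \<le> (\<Sum>i\<in>(Basis::'a set). norm h * e')"
    proof (rule order_trans[OF sum_abs sum_mono])
      fix i :: 'a assume i: "i \<in> Basis"
      have "dist (y + t *\<^sub>R h) y \<le> norm h"
        using t(1) by (simp add: dist_norm mult_left_le_one_le)
      then have "dist (y + t *\<^sub>R h) y < \<delta> i" using h d(2)[OF i] by linarith
      then have "\<bar>pd i g (y + t *\<^sub>R h) - pd i g y\<bar> \<le> e'"
        using \<delta>(2)[OF i] by (metis dist_real_def less_imp_le)
      then show "\<bar>(h \<bullet> i) * (pd i g (y + t *\<^sub>R h) - pd i g y)\<bar> \<le> norm h * e'"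
        using Basis_le_norm[OF i, of h] by (simp add: abs_mult mult_mono)
    qed
    also have "\<dots> = e * norm h" by (simp add: e'_def)
    finally show ?thesis .
  qed
  with d(1) show thesis by (rule that)
qed

text \<open>Serves twice: with \<open>p u\<close> and the indicator of a ball it is a truncated
  semigroup operator, with \<open>lborel\<close> and a reflected function it is a mollification. The
  argument z + x follows \<open>Psg\<close>.\<close>

definition wconv :: "'a::euclidean_space measure \<Rightarrow> ('a \<Rightarrow> real) \<Rightarrow> ('a \<Rightarrow> real) \<Rightarrow> 'a \<Rightarrow> real" where
  "wconv \<nu> w g x = (\<integral>z. w z * g (z + x) \<partial>\<nu>)"

context
  fixes \<nu> :: "'a::euclidean_space measure" and w :: "'a \<Rightarrow> real"
  assumes sets_\<nu>[measurable_cong]: "sets \<nu> = sets borel" and w: "integrable \<nu> w"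
begin

lemma integrable_wconv:
  assumes "C0 g"
  shows "integrable \<nu> (\<lambda>z. w z * g (z + x))"
proof -
  obtain M where M: "M > 0" "\<And>x. \<bar>g x\<bar> \<le> M" using C0_bounded[OF assms] by metis
  have [measurable]: "g \<in> borel_measurable borel"
    using assms by (auto simp: C0_def intro: borel_measurable_continuous_onI)
  have [measurable]: "w \<in> borel_measurable \<nu>" using w by auto
  have "norm (w z * g (z + x)) \<le> norm (M * norm (w z))" for z
    using M(1) mult_right_mono[OF M(2), of "\<bar>w z\<bar>" "z + x"] by (simp add: abs_mult mult.commute)
  then show ?thesis
    by (intro Bochner_Integration.integrable_bound[OF integrable_mult_right[of M, OF integrable_norm[OF w]]]) auto
qed

text \<open>The linearization error of \<open>g\<close> is uniform in the base point, so it
  integrates to a small multiple of the L1 norm of \<open>w\<close>.\<close>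

lemma wconv_has_derivative:
  assumes "test_fun g"
  shows "(wconv \<nu> w g has_derivative (\<lambda>h. \<Sum>i\<in>Basis. (h \<bullet> i) * wconv \<nu> w (pd i g) x)) (at x)"
  unfolding has_derivative_at_alt
proof (intro conjI allI impI)
  show "bounded_linear (\<lambda>h. \<Sum>i\<in>Basis. h \<bullet> i * wconv \<nu> w (pd i g) x)"
    by (intro bounded_linear_sum bounded_linear_mult_const bounded_linear_inner_left)
  fix e :: real assume e: "e > 0"
  \<comment> \<open>Dividing by \<open>W + 1\<close> rather than \<open>W\<close> also covers a
    weight that vanishes almost everywhere.\<close>
  define W where "W = (\<integral>z. \<bar>w z\<bar> \<partial>\<nu>)"
  have W: "W \<ge> 0" by (simp add: W_def)
  obtain d where d: "d > 0"
    "\<And>y h. norm h < d \<Longrightarrow> \<bar>g (y + h) - g y - (\<Sum>i\<in>Basis. (h \<bullet> i) * pd i g y)\<bar> \<le> e / (W + 1) * norm h"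
    using test_fun_uniform_linearization[OF assms, of "e / (W + 1)"] e W by auto
  have int: "integrable \<nu> (\<lambda>z. w z * g (z + x))" for x
    by (rule integrable_wconv[OF test_fun_C0[OF assms]])
  have int': "integrable \<nu> (\<lambda>z. w z * pd i g (z + x))" if "i \<in> Basis" for i
    by (rule integrable_wconv[OF test_fun_C0[OF test_fun_pd[OF assms that]]])
  have "\<bar>wconv \<nu> w g y - wconv \<nu> w g x - (\<Sum>i\<in>Basis. (y - x) \<bullet> i * wconv \<nu> w (pd i g) x)\<bar> \<le> e * norm (y - x)"
    if y: "norm (y - x) < d" for y
  proof -
    define R where "R z = g (z + x + (y - x)) - g (z + x) - (\<Sum>i\<in>Basis. (y - x) \<bullet> i * pd i g (z + x))" for z
    have R: "\<bar>R z\<bar> \<le> e / (W + 1) * norm (y - x)" for z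
      unfolding R_def by (rule d(2)[OF y])
    have eq: "w z * R z = w z * g (z + y) - w z * g (z + x) - (\<Sum>i\<in>Basis. (y - x) \<bullet> i * (w z * pd i g (z + x)))" for z
      by (simp add: R_def right_diff_distrib sum_distrib_left mult_ac)
    have intR: "integrable \<nu> (\<lambda>z. w z * R z)"
      unfolding eq using int int' by (intro Bochner_Integration.integrable_diff Bochner_Integration.integrable_sum integrable_mult_right) auto
    have "wconv \<nu> w g y - wconv \<nu> w g x - (\<Sum>i\<in>Basis. (y - x) \<bullet> i * wconv \<nu> w (pd i g) x) = (\<integral>z. w z * R z \<partial>\<nu>)"
      unfolding eq wconv_def using int int'
      by (simp add: Bochner_Integration.integral_diff Bochner_Integration.integral_sum)
    also have "\<bar>\<dots>\<bar> \<le> (\<integral>z. \<bar>w z * R z\<bar> \<partial>\<nu>)" by (rule integral_abs_bound)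
    also have "\<dots> \<le> (\<integral>z. \<bar>w z\<bar> * (e / (W + 1) * norm (y - x)) \<partial>\<nu>)"
    proof (rule integral_mono)
      show "integrable \<nu> (\<lambda>z. \<bar>w z * R z\<bar>)" by (rule integrable_abs[OF intR])
      show "integrable \<nu> (\<lambda>z. \<bar>w z\<bar> * (e / (W + 1) * norm (y - x)))"
        by (rule integrable_mult_left[OF integrable_abs[OF w]])
      show "\<bar>w z * R z\<bar> \<le> \<bar>w z\<bar> * (e / (W + 1) * norm (y - x))" for z
        unfolding abs_mult by (rule mult_left_mono[OF R]) simp
    qed
    also have "\<dots> = W / (W + 1) * (e * norm (y - x))" by (simp add: W_def)
    also have "\<dots> \<le> 1 * (e * norm (y - x))"
      using W e by (intro mult_right_mono) auto
    finally show ?thesis by simp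
  qed
  with d(1) show "\<exists>d>0. \<forall>y. norm (y - x) < d \<longrightarrow> norm (wconv \<nu> w g y - wconv \<nu> w g x -
      (\<Sum>i\<in>Basis. (y - x) \<bullet> i * wconv \<nu> w (pd i g) x)) \<le> e * norm (y - x)"
    by auto
qed

text \<open>Derivatives fall on \<open>g\<close>, and \<open>pd i g\<close> is again a test
  function, so the induction runs over all \<open>g\<close> at once.\<close>

lemma smooth_wconv:
  assumes "test_fun g"
  shows "smooth (wconv \<nu> w g)"
proof -
  have "ndiff n (wconv \<nu> w g)" for n using assms
  proof (induction n arbitrary: g)
    case 0
    then show ?case by (auto intro: differentiableI wconv_has_derivative)
  next
    case (Suc n)
    have "pd i (wconv \<nu> w g) = wconv \<nu> w (pd i g)" if "i \<in> Basis" for i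
      using that by (intro ext) (simp add: pd_eqI[OF wconv_has_derivative[OF Suc.prems]] inner_Basis if_distrib[of "\<lambda>x. x * _"] cong: if_cong)
    with Suc show ?case by (auto intro: differentiableI wconv_has_derivative test_fun_pd)
  qed
  then show ?thesis by (simp add: smooth_iff_ndiff)
qed

lemma test_fun_wconv:
  assumes "test_fun g" "\<And>z. norm z > R \<Longrightarrow> w z = 0"
  shows "test_fun (wconv \<nu> w g)"
proof -
  obtain S where S: "\<And>x. norm x \<ge> S \<Longrightarrow> g x = 0" using test_funE[OF assms(1)] by metis
  show ?thesis
  proof (rule test_funI[of _ "R + S"])
    show "smooth (wconv \<nu> w g)" by (rule smooth_wconv[OF assms(1)])
    fix x :: 'a assume x: "norm x > R + S"
    have zero: "w z * g (z + x) = 0" for z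
    proof (cases "norm z > R")
      case False
      then have "norm (z + x) \<ge> S" using x norm_triangle_ineq2[of x "- z"] by (simp add: add.commute)
      then show ?thesis by (simp add: S)
    qed (simp add: assms(2))
    show "wconv \<nu> w g x = 0" unfolding wconv_def zero by simp
  qed
qed

end

section \<open>Uniform density of the test functions\<close>

lemma integral_lborel_bump_pos:
  assumes "r > 0"
  shows "(\<integral>x. bump r x \<partial>(lborel :: 'a::euclidean_space measure)) > 0"
    and "integrable lborel (bump r :: 'a \<Rightarrow> real)"
proof -
  have cont: "continuous_on UNIV (bump r :: 'a \<Rightarrow> real)" by (rule smooth_continuous[OF smooth_bump])
  have "integrable lborel (\<lambda>x::'a. indicator (cball 0 r) x *\<^sub>R bump r x)"
    by (intro borel_integrable_compact continuous_on_subset[OF cont]) auto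
  also have "(\<lambda>x::'a. indicator (cball 0 r) x *\<^sub>R bump r x) = bump r"
    by (auto simp: indicator_def fun_eq_iff bump_eq_0[OF assms] not_le less_imp_le)
  finally show int: "integrable lborel (bump r :: 'a \<Rightarrow> real)" .
  have "(\<integral>x. bump r x \<partial>(lborel :: 'a measure)) \<noteq> 0"
  proof
    assume "(\<integral>x. bump r x \<partial>(lborel :: 'a measure)) = 0"
    then have "AE x in (lborel :: 'a measure). bump r x = 0"
      using integral_nonneg_eq_0_iff_AE[OF int] by (simp add: bump_nonneg)
    then have "AE x in (lborel :: 'a measure). x \<notin> ball 0 r"
      by eventually_elim (use bump_pos_iff[OF assms] in force)
    then have "emeasure (lborel :: 'a measure) (ball 0 r) = 0"
      by (subst (asm) AE_iff_measurable[of "ball 0 r"]) auto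
    then have "negligible (ball (0::'a) r)"
      by (simp add: negligible_iff_emeasure0)
    then show False using open_not_negligible[of "ball (0::'a) r"] assms by simp
  qed
  moreover have "(\<integral>x. bump r x \<partial>(lborel :: 'a measure)) \<ge> 0"
    by (intro integral_nonneg_AE) (simp add: bump_nonneg)
  ultimately show "(\<integral>x. bump r x \<partial>(lborel :: 'a measure)) > 0" by linarith
qed

lemma test_fun_bump: "r > 0 \<Longrightarrow> test_fun (bump r)"
  by (rule test_funI[of _ r]) (auto simp: smooth_bump bump_eq_0)

lemma test_fun_cmult: "test_fun g \<Longrightarrow> test_fun (\<lambda>x. c * g x)"
  by (erule test_funE, rule test_funI[where f = "\<lambda>x. c * g x"])
     (auto intro!: smooth_mult smooth_const less_imp_le)

lemma test_fun_dense_C0: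
  fixes f :: "'a::euclidean_space \<Rightarrow> real"
  assumes "C0 f" "e > 0"
  obtains g where "test_fun g" "\<And>x. \<bar>g x - f x\<bar> \<le> e"
proof -
  \<comment> \<open>Soft thresholding: \<open>f1\<close> is continuous, differs from
    \<open>f\<close> by at most e/2, and vanishes wherever \<open>f\<close> is at most e/2 in
    absolute value, hence outside a ball.\<close>
  define f1 where "f1 x = f x - max (- (e / 2)) (min (e / 2) (f x))" for x
  have f1_f: "\<bar>f1 x - f x\<bar> \<le> e / 2" for x using assms(2) by (auto simp: f1_def)
  have "eventually (\<lambda>x. dist (f x) 0 < e / 2) at_infinity"
    using assms unfolding C0_def by (blast intro: tendstoD half_gt_zero)
  then obtain R where "\<And>x. norm x \<ge> R \<Longrightarrow> \<bar>f x\<bar> < e / 2"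
    by (auto simp: eventually_at_infinity)
  then have R: "f1 x = 0" if "norm x \<ge> R" for x using that by (force simp: f1_def)
  have cont: "continuous_on UNIV f1" unfolding f1_def
    using assms(1) by (intro continuous_intros) (auto simp: C0_def)
  have "C0 f1" by (rule C0_compact_support[OF cont R])
  then have "uniformly_continuous_on UNIV f1" by (rule C0_uniformly_continuous)
  then obtain r where r: "r > 0" "\<And>x y. dist y x < r \<Longrightarrow> dist (f1 y) (f1 x) < e / 2"
    unfolding uniformly_continuous_on_def using assms(2) by (meson UNIV_I half_gt_zero)
  define c where "c = (\<integral>x. bump r x \<partial>(lborel :: 'a measure))"
  have c: "c > 0" and int_b: "integrable lborel (bump r :: 'a \<Rightarrow> real)"
    using integral_lborel_bump_pos[OF r(1)] by (auto simp: c_def)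
  \<comment> \<open>The reflection turns \<open>wconv\<close>, after the substitution y = z + x,
    into the usual convolution of \<open>bump r\<close> and \<open>f1\<close>.\<close>
  define w where "w z = f1 (- z)" for z
  have w: "integrable lborel w"
  proof -
    have "integrable lborel (\<lambda>x::'a. indicator (cball 0 R) x *\<^sub>R w x)"
      unfolding w_def
      by (intro borel_integrable_compact continuous_on_compose2[OF cont] continuous_intros) auto
    also have "(\<lambda>x::'a. indicator (cball 0 R) x *\<^sub>R w x) = w"
      using R by (auto simp: w_def indicator_def fun_eq_iff)
    finally show ?thesis .
  qed
  \<comment> \<open>The bump takes the slot that passes on smoothness; \<open>f1\<close> takes the
    weight slot, where integrability and bounded support suffice.\<close>
  define g where "g = (\<lambda>x. (1 / c) * wconv lborel w (bump r) x)"
  have g: "test_fun g" unfolding g_def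
    by (intro test_fun_cmult test_fun_wconv[where R = R] w test_fun_bump r(1)) (auto simp: w_def R)
  have g_f1: "\<bar>g x - f1 x\<bar> \<le> e / 2" for x
  proof -
    have int: "integrable lborel (\<lambda>z. w z * bump r (z + x))"
      by (intro integrable_wconv w test_fun_C0 test_fun_bump r(1)) simp
    have meas[measurable]: "f1 \<in> borel_measurable borel" "(bump r :: 'a \<Rightarrow> real) \<in> borel_measurable borel"
      using cont smooth_continuous[OF smooth_bump] by (auto intro: borel_measurable_continuous_onI)
    have shift: "integrable lborel (\<lambda>y. bump r y * f1 (x - y))"
      "wconv lborel w (bump r) x = (\<integral>y. bump r y * f1 (x - y) \<partial>lborel)"
    proof -
      have *: "integrable (distr lborel borel ((+) x)) (\<lambda>y. bump r y * f1 (x - y)) \<longleftrightarrow>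
          integrable lborel (\<lambda>z. bump r (x + z) * f1 (x - (x + z)))"
        by (intro integrable_distr_eq) auto
      show "integrable lborel (\<lambda>y. bump r y * f1 (x - y))"
        using int * unfolding lborel_distr_plus by (simp add: w_def mult.commute add.commute)
      have "integral\<^sup>L (distr lborel borel ((+) x)) (\<lambda>y. bump r y * f1 (x - y)) =
          (\<integral>z. bump r (x + z) * f1 (x - (x + z)) \<partial>lborel)"
        by (intro integral_distr) auto
      then show "wconv lborel w (bump r) x = (\<integral>y. bump r y * f1 (x - y) \<partial>lborel)"
        unfolding lborel_distr_plus by (simp add: wconv_def w_def mult.commute add.commute)
    qed
    have eq: "c * (g x - f1 x) = (\<integral>y. bump r y * (f1 (x - y) - f1 x) \<partial>lborel)"
      using c int_b shift by (simp add: g_def right_diff_distrib c_def)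
    have "\<bar>c * (g x - f1 x)\<bar> \<le> (\<integral>y. \<bar>bump r y * (f1 (x - y) - f1 x)\<bar> \<partial>lborel)"
      unfolding eq by (rule integral_abs_bound)
    also have "\<dots> \<le> (\<integral>y. bump r y * (e / 2) \<partial>(lborel :: 'a measure))"
    proof (rule integral_mono)
      show "integrable lborel (\<lambda>y. \<bar>bump r y * (f1 (x - y) - f1 x)\<bar>)"
        using shift(1) int_b by (simp add: right_diff_distrib)
      show "integrable lborel (\<lambda>y::'a. bump r y * (e / 2))" using int_b by simp
      fix y :: 'a
      show "\<bar>bump r y * (f1 (x - y) - f1 x)\<bar> \<le> bump r y * (e / 2)"
      proof (cases "norm y < r")
        case True
        then have "\<bar>f1 (x - y) - f1 x\<bar> \<le> e / 2"
          using r(2)[of "x - y" x] by (simp add: dist_norm)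
        then show ?thesis unfolding abs_mult abs_of_nonneg[OF bump_nonneg]
          by (rule mult_left_mono[OF _ bump_nonneg])
      qed (simp add: bump_eq_0[OF r(1)])
    qed
    also have "\<dots> = c * (e / 2)" by (simp add: c_def)
    finally have "c * \<bar>g x - f1 x\<bar> \<le> c * (e / 2)" using c by (simp add: abs_mult)
    then show ?thesis using c by simp
  qed
  have "\<bar>g x - f x\<bar> \<le> e" for x using f1_f[of x] g_f1[of x] by linarith
  with g show thesis by (rule that)
qed

section \<open>Weak derivatives on the half line\<close>

text \<open>Products are the functions inserted into the integral hypothesis, because for fixed u
  linearity lets \<open>A\<close> act on \<open>f\<close> alone.\<close>

lemma test_fun_prod:
  fixes \<eta> :: "real \<Rightarrow> real" and f :: "'a::euclidean_space \<Rightarrow> real"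
  assumes "test_fun \<eta>" "test_fun f"
  shows "test_fun (\<lambda>q. \<eta> (fst q) * f (snd q))"
proof -
  obtain R where R: "smooth \<eta>" "\<And>x. norm x \<ge> R \<Longrightarrow> \<eta> x = 0" using test_funE[OF assms(1)] by metis
  obtain S where S: "smooth f" "\<And>x. norm x \<ge> S \<Longrightarrow> f x = 0" using test_funE[OF assms(2)] by metis
  show ?thesis
  proof (rule test_funI[of _ "R + S"])
    have "smooth (\<lambda>q::real \<times> 'a. \<eta> (fst q))"
      by (rule smooth_compose_linear[OF bounded_linear_fst _ R(1)]) (auto simp: Basis_prod_def)
    moreover have "smooth (\<lambda>q::real \<times> 'a. f (snd q))"
      by (rule smooth_compose_linear[OF bounded_linear_snd _ S(1)]) (auto simp: Basis_prod_def)
    ultimately show "smooth (\<lambda>q. \<eta> (fst q) * f (snd q))" by (rule smooth_mult)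
    fix q :: "real \<times> 'a" assume q: "norm q > R + S"
    have "norm q \<le> norm (fst q) + norm (snd q)" using norm_Pair_le[of "fst q" "snd q"] by simp
    with q have "norm (fst q) \<ge> R \<or> norm (snd q) \<ge> S" by linarith
    then show "\<eta> (fst q) * f (snd q) = 0" using R(2) S(2) by auto
  qed
qed

lemma continuous_real_antiderivative:
  fixes f :: "real \<Rightarrow> real"
  assumes "continuous_on UNIV f"
  obtains F where "\<And>x. (F has_real_derivative f x) (at x)"
proof (rule that)
  fix x :: real
  \<comment> \<open>Both 0 and \<open>x\<close> are interior to the interval, so the derivative
    within it is the full derivative at \<open>x\<close>.\<close>
  define a where "a = min 0 x - 1"
  define b where "b = max 0 x + 1"
  have "((\<lambda>u. LBINT y=0..u. f y) has_vector_derivative (f x)) (at x within {a..b})"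
    using interval_integral_FTC2[of a 0 b f x] continuous_on_subset[OF assms]
    by (auto simp: a_def b_def zero_ereal_def)
  moreover have "at x within {a..b} = at x"
    by (intro at_within_interior) (auto simp: a_def b_def)
  ultimately show "((\<lambda>u::real. LBINT y=0..u. f y) has_real_derivative f x) (at x)"
    by (simp add: has_real_derivative_iff_has_vector_derivative)
qed

lemma smooth_has_real_derivative:
  fixes f :: "real \<Rightarrow> real"
  assumes "smooth f"
  shows "(f has_real_derivative deriv f x) (at x)" "continuous_on UNIV (deriv f)"
proof -
  show d: "(f has_real_derivative deriv f x) (at x)" for x
    using smooth_differentiable[OF assms, of x]
    by (simp add: DERIV_deriv_iff_real_differentiable)
  have "pd 1 f = deriv f" by (rule ext, rule pd_real, rule d)
  then show "continuous_on UNIV (deriv f)"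
    using smooth_continuous[OF smooth_pd[OF assms, of 1]] by simp
qed

text \<open>The even test function \<open>\<eta> u = H (u\<^sup>2)\<close>, with \<open>H\<close> a smooth step located at \<open>t\<^sup>2\<close>, is compactly supported
  and its derivative on the half line has one sign and concentrates at \<open>t\<close>.\<close>

lemma test_fun_step_at:
  fixes t e :: real
  assumes "e > 0"
  obtains \<eta> where "test_fun \<eta>" "\<And>u. deriv \<eta> u = - 2 * u * bump e (u\<^sup>2 - t\<^sup>2)"
proof -
  define \<psi> :: "real \<Rightarrow> real" where "\<psi> v = bump e (v - t\<^sup>2)" for v
  have "smooth (\<lambda>v::real. v + (- t\<^sup>2))"
    by (intro smooth_add smooth_const smooth_linear bounded_linear_ident)
  then have "smooth (\<lambda>v::real. bump e (v + (- t\<^sup>2)))"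
    by (rule smooth_compose_real[OF smooth_bump])
  then have \<psi>: "smooth \<psi>" by (simp add: \<psi>_def[abs_def])
  obtain \<Psi> where \<Psi>: "\<And>x. (\<Psi> has_real_derivative \<psi> x) (at x)"
    using continuous_real_antiderivative[OF smooth_continuous[OF \<psi>]] by metis
  \<comment> \<open>The right end of the support of \<open>\<psi>\<close>, from which on
    \<open>\<Psi>\<close> is constant.\<close>
  define B where "B = t\<^sup>2 + e"
  have \<Psi>_const: "\<Psi> v = \<Psi> B" if v: "v \<ge> B" for v
  proof (cases "v = B")
    case False
    then obtain z where z: "B < z" "\<Psi> v - \<Psi> B = (v - B) * \<psi> z"
      using MVT2[of B v \<Psi> \<psi>] v \<Psi> by force
    have "\<psi> z = 0" unfolding \<psi>_def using z(1) by (intro bump_eq_0[OF assms]) (simp add: B_def)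
    with z(2) show ?thesis by simp
  qed simp
  define \<eta> where "\<eta> u = \<Psi> B + (-1) * \<Psi> (u * u)" for u
  have "smooth (\<lambda>u::real. u * u)"
    by (intro smooth_mult smooth_linear bounded_linear_ident)
  then have "smooth (\<lambda>u::real. \<Psi> (u * u))"
    by (rule smooth_compose_real[OF smooth_real_antiderivative[OF \<Psi> \<psi>]])
  then have "smooth \<eta>" unfolding \<eta>_def[abs_def] by (intro smooth_add smooth_mult smooth_const)
  then have "test_fun \<eta>"
  proof (rule test_funI)
    fix u :: real assume u: "norm u > B + 1"
    \<comment> \<open>The margin 1 in \<open>B + 1\<close> gives |u| >= 1, whence u^2 >= |u| >=
      \<open>B\<close> without square roots.\<close>
    have "1 \<le> \<bar>u\<bar>" using u assms by (simp add: B_def) (smt (verit) zero_le_power2)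
    then have "\<bar>u\<bar> * 1 \<le> \<bar>u\<bar> * \<bar>u\<bar>" by (intro mult_left_mono) auto
    then have "u * u \<ge> B" using u by simp
    then show "\<eta> u = 0" using \<Psi>_const[of "u * u"] by (simp add: \<eta>_def)
  qed
  moreover have "deriv \<eta> u = - 2 * u * bump e (u\<^sup>2 - t\<^sup>2)" for u
    unfolding \<eta>_def
    by (rule DERIV_imp_deriv)
       (auto intro!: derivative_eq_intros DERIV_chain2[OF \<Psi>] simp: \<psi>_def power2_eq_square)
  ultimately show thesis by (rule that)
qed

text \<open>A du Bois-Reymond argument: the defect \<open>h\<close> is orthogonal to every
  \<open>deriv \<eta>\<close>, and derivatives of one sign concentrated near \<open>t\<close> force
  \<open>h t = 0\<close>. Test functions need not vanish at 0; the boundary term fixes the constant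
  of integration.\<close>

lemma weak_derivative_half_line:
  fixes a b :: "real \<Rightarrow> real"
  assumes a: "continuous_on {0..} a" and b: "continuous_on {0..} b"
    and weak: "\<And>\<eta>. test_fun \<eta> \<Longrightarrow>
      (LINT u:{0..}|lborel. deriv \<eta> u * a u + \<eta> u * b u) = - \<eta> 0 * a 0"
    and "t \<ge> 0"
  shows "a t - a 0 = integral {0..t} b"
proof -
  define G where "G u = integral {0..u} b" for u
  define h where "h u = a u - a 0 - G u" for u
  have b_int: "b integrable_on {0..u}" for u
    by (intro integrable_continuous_real continuous_on_subset[OF b]) auto
  have G_deriv: "(G has_real_derivative b u) (at u within {0..T})" if "u \<in> {0..T}" for u T
    unfolding G_def
    by (rule integral_has_real_derivative[OF _ that]) (rule continuous_on_subset[OF b], auto)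
  have G_cont: "continuous_on {0..} G"
    unfolding continuous_on_eq_continuous_within
  proof
    fix u :: real assume u: "u \<in> {0..}"
    have "continuous (at u within {0..u + 1}) G"
      using G_deriv[of u "u + 1"] u by (intro DERIV_continuous) auto
    moreover have "at u within {0..u + 1} = at u within {0..}"
      by (rule at_within_nhd[of _ "{..<u + 1}"]) (use u in auto)
    ultimately show "continuous (at u within {0..}) G" by simp
  qed
  have h_cont: "continuous_on {0..} h"
    unfolding h_def by (intro continuous_intros a G_cont)
  have ortho: "integral {0..T} (\<lambda>u. deriv \<eta> u * h u) = 0"
    if \<eta>: "test_fun \<eta>" and T: "T > 0" "\<And>u. u \<ge> T \<Longrightarrow> \<eta> u = 0" for \<eta> T
  proof -
    have sm: "smooth \<eta>" using \<eta> by (simp add: test_fun_def)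
    note d = smooth_has_real_derivative[OF sm]
    have cont: "continuous_on {0..T} \<eta>" "continuous_on {0..T} (deriv \<eta>)" "continuous_on {0..T} a"
      "continuous_on {0..T} b" "continuous_on {0..T} G"
      using smooth_continuous[OF sm] d(2) a b G_cont by (auto intro: continuous_on_subset)
    have deriv0: "deriv \<eta> u = 0" if "u > T" for u
    proof (rule DERIV_imp_deriv)
      show "(\<eta> has_real_derivative 0) (at u)"
        by (rule has_field_derivative_transform_within_open[OF DERIV_const, where S = "{T<..}"])
           (use that T in auto)
    qed
    have "(LINT u:{0..}|lborel. deriv \<eta> u * a u + \<eta> u * b u) = (LINT u:{0..T}|lborel. deriv \<eta> u * a u + \<eta> u * b u)"
      unfolding set_lebesgue_integral_def
      by (rule Bochner_Integration.integral_cong) (auto simp: indicator_def T deriv0)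
    also have "\<dots> = integral {0..T} (\<lambda>u. deriv \<eta> u * a u + \<eta> u * b u)"
      by (intro set_borel_integral_eq_integral borel_integrable_atLeastAtMost' continuous_intros cont)
    finally have I1: "integral {0..T} (\<lambda>u. deriv \<eta> u * a u + \<eta> u * b u) = - \<eta> 0 * a 0"
      using weak[OF \<eta>] by simp
    \<comment> \<open>The candidate a 0 + G satisfies the same identity as \<open>a\<close>: the
      integrand is the derivative of \<eta> (a 0 + G), and the boundary term at \<open>T\<close>
      vanishes. Subtracting leaves \<open>h\<close>.\<close>
    have "((\<lambda>u. deriv \<eta> u * (a 0 + G u) + \<eta> u * b u) has_integral
        (\<eta> T * (a 0 + G T) - \<eta> 0 * (a 0 + G 0))) {0..T}"
      using T(1)
      by (intro fundamental_theorem_of_calculus)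
         (auto simp: has_real_derivative_iff_has_vector_derivative[symmetric]
           intro!: derivative_eq_intros has_field_derivative_at_within[OF d(1)] G_deriv)
    then have I2: "((\<lambda>u. deriv \<eta> u * (a 0 + G u) + \<eta> u * b u) has_integral (- \<eta> 0 * a 0)) {0..T}"
      using T by (simp add: G_def)
    have "(\<lambda>u. deriv \<eta> u * a u + \<eta> u * b u) integrable_on {0..T}"
      by (intro integrable_continuous_real continuous_intros cont)
    then have "((\<lambda>u. deriv \<eta> u * a u + \<eta> u * b u) has_integral (- \<eta> 0 * a 0)) {0..T}"
      using I1 by (simp add: has_integral_iff)
    from has_integral_diff[OF this I2]
    have "((\<lambda>u. deriv \<eta> u * h u) has_integral 0) {0..T}"
      by (simp add: h_def algebra_simps)
    then show ?thesis by (rule integral_unique)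
  qed
  have "h t = 0"
  proof (rule ccontr)
    assume ht: "h t \<noteq> 0"
    \<comment> \<open>\<open>deriv \<eta>\<close> carries the factor u and detects nothing at 0, but
      there \<open>h\<close> vanishes by construction.\<close>
    have "h 0 = 0" by (simp add: h_def G_def)
    with ht assms(4) have t: "t > 0" by (cases "t = 0") auto
    \<comment> \<open>The bump localises in u^2, so continuity is needed for \<open>h\<close>
      composed with the square root, at t^2. The factor \<open>h t\<close> makes the value there
      positive whatever the sign of \<open>h t\<close>.\<close>
    have "continuous_on {0..} (\<lambda>v. h t * h (sqrt v))"
      by (intro continuous_intros continuous_on_compose2[OF h_cont]) auto
    moreover have "h t * h (sqrt (t\<^sup>2)) > 0" using t ht by (simp add: not_sum_power2_lt_zero) (metis not_real_square_gt_zero)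
    ultimately obtain e where e: "e > 0"
      "\<And>v. v \<ge> 0 \<Longrightarrow> dist v (t\<^sup>2) < e \<Longrightarrow> dist (h t * h (sqrt v)) (h t * h (sqrt (t\<^sup>2))) < h t * h (sqrt (t\<^sup>2))"
      unfolding continuous_on_iff by (metis atLeast_iff zero_le_power2)
    obtain \<eta> where \<eta>: "test_fun \<eta>" "\<And>u. deriv \<eta> u = - 2 * u * bump e (u\<^sup>2 - t\<^sup>2)"
      using test_fun_step_at[OF e(1)] by metis
    obtain R where R: "R > 0" "\<And>x. norm x \<ge> R \<Longrightarrow> \<eta> x = 0" using test_funE[OF \<eta>(1)] by metis
    define T where "T = max R t"
    have T: "T > 0" "t \<in> {0..T}" using t by (auto simp: T_def)
    \<comment> \<open>The sign makes \<open>k\<close> nonnegative: \<open>deriv \<eta>\<close> is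
      nonpositive on the half line, and where the bump is nonzero \<open>h u\<close> has the sign of
      \<open>h t\<close>.\<close>
    define k where "k u = - (h t) * (deriv \<eta> u * h u)" for u
    have "integral {0..T} k = 0"
      unfolding k_def using ortho[OF \<eta>(1) T(1)] R by (simp add: T_def)
    moreover have "continuous_on {0..T} k"
      unfolding k_def using smooth_has_real_derivative(2)[of \<eta>] \<eta>(1)
      by (intro continuous_intros continuous_on_subset[OF h_cont])
         (auto simp: test_fun_def intro: continuous_on_subset)
    moreover have "k u \<ge> 0" if "u \<in> {0..T}" for u
    proof (cases "norm (u\<^sup>2 - t\<^sup>2) < e")
      case True
      then have "dist (h t * h u) (h t * h t) < h t * h t"
        using e(2)[of "u\<^sup>2"] that t by (simp add: dist_real_def)
      then have "h t * h u \<ge> 0" by (simp add: dist_real_def)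
      moreover have "2 * u * bump e (u\<^sup>2 - t\<^sup>2) \<ge> 0" using that by (simp add: bump_nonneg)
      ultimately have "(h t * h u) * (2 * u * bump e (u\<^sup>2 - t\<^sup>2)) \<ge> 0" by (rule mult_nonneg_nonneg)
      then show ?thesis by (simp add: k_def \<eta>(2) mult_ac)
    qed (simp add: k_def \<eta>(2) bump_eq_0[OF e(1)])
    ultimately have "k t = 0" using integral_eq_0_iff[of 0 T k] T by auto
    moreover have "bump e (0::real) > 0" using bump_pos_iff[OF e(1), of "0::real"] e(1) by simp
    ultimately show False using t ht by (simp add: k_def \<eta>(2))
  qed
  then show ?thesis by (simp add: h_def G_def)
qed

section \<open>Strong continuity and averages of the semigroup\<close>

lemma C0_borel_measurable: "C0 f \<Longrightarrow> f \<in> borel_measurable borel"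
  by (auto simp: C0_def intro: borel_measurable_continuous_onI)

text \<open>Without integrability the integral is 0 by convention, so the bound persists; later
  estimates thereby avoid measurability arguments.\<close>

lemma (in prob_space) abs_integral_le:
  fixes h :: "'a \<Rightarrow> real"
  assumes "\<And>z. \<bar>h z\<bar> \<le> B"
  shows "\<bar>\<integral>z. h z \<partial>M\<bar> \<le> B"
proof (cases "integrable M h")
  case True
  have "\<bar>\<integral>z. h z \<partial>M\<bar> \<le> (\<integral>z. \<bar>h z\<bar> \<partial>M)" by (rule integral_abs_bound)
  also have "\<dots> \<le> (\<integral>z. B \<partial>M)" using True assms by (intro integral_mono) auto
  finally show ?thesis by (simp add: prob_space)
next
  case False
  have "0 \<le> B" using assms[of undefined] by linarith
  with False show ?thesis by (simp add: not_integrable_integral_eq)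
qed

lemma integrable_C0_shift:
  fixes M :: "'a::euclidean_space measure"
  assumes "prob_space M" "sets M = sets borel" "C0 g"
  shows "integrable M (\<lambda>z. g (z + x))"
proof -
  interpret prob_space M by fact
  show ?thesis using integrable_wconv[OF assms(2) integrable_const[of 1] assms(3)] by simp
qed

text \<open>The mesh \<open>d\<close> is fixed and the interval grows with \<open>m\<close>, so each
  induction step adds one cell with error at most d * e.\<close>

lemma integral_riemann_sum_error:
  fixes c :: "real \<Rightarrow> real"
  assumes "d \<ge> 0" "continuous_on {0..} c"
    and "\<And>u v. 0 \<le> u \<Longrightarrow> u \<le> v \<Longrightarrow> v \<le> u + d \<Longrightarrow> \<bar>c v - c u\<bar> \<le> e"
  shows "\<bar>integral {0..real m * d} c - d * (\<Sum>k<m. c (real k * d))\<bar> \<le> real m * d * e"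
proof (induction m)
  case (Suc m)
  define s where "s = real m * d"
  have s: "s \<ge> 0" "real (Suc m) * d = s + d" using assms(1) by (auto simp: s_def algebra_simps)
  have int: "c integrable_on {a..b}" if "a \<ge> 0" for a b
    using that by (intro integrable_continuous_real continuous_on_subset[OF assms(2)]) auto
  have "integral {0..s} c + integral {s..s + d} c = integral {0..s + d} c"
    using s assms(1) int by (intro Henstock_Kurzweil_Integration.integral_combine) auto
  moreover have "\<bar>integral {s..s + d} c - d * c s\<bar> \<le> d * e"
  proof -
    have "norm (integral {s..s + d} (\<lambda>u. c u - c s)) \<le> e * (s + d - s)"
      using s(1) assms(1,2,3) by (intro integral_bound continuous_intros continuous_on_subset[OF assms(2)]) auto
    moreover have "integral {s..s + d} (\<lambda>u. c u - c s) = integral {s..s + d} c - d * c s"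
      using Henstock_Kurzweil_Integration.integral_diff[OF int[OF s(1), of "s + d"] integrable_const_ivl[of "c s"]] assms(1)
      by simp
    ultimately show ?thesis by (simp add: mult.commute)
  qed
  moreover have "d * (\<Sum>k<Suc m. c (real k * d)) = d * (\<Sum>k<m. c (real k * d)) + d * c s"
    by (simp add: s_def distrib_left)
  moreover have "(s + d) * e = s * e + d * e" by (rule distrib_right)
  ultimately show ?case using Suc.IH unfolding s(2) s_def[symmetric] by linarith
qed simp

text \<open>Supplies Fubini's theorem twice: with weight 1 for the semigroup law, with a bounded
  weight for commuting with \<open>wconv\<close>.\<close>

lemma integrable_pair_C0:
  fixes g w :: "'a::euclidean_space \<Rightarrow> real"
  assumes "prob_space M" "prob_space N" "sets M = sets borel" "sets N = sets borel" "C0 g"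
    "w \<in> borel_measurable borel" "\<And>z. \<bar>w z\<bar> \<le> 1"
  shows "integrable (M \<Otimes>\<^sub>M N) (\<lambda>(y, z). w y * g (y + z + x))"
proof -
  interpret M: prob_space M by fact
  interpret N: prob_space N by fact
  interpret MN: pair_prob_space M N ..
  note [measurable_cong] = assms(3,4)
  have [measurable]: "g \<in> borel_measurable borel" "w \<in> borel_measurable borel"
    using assms(5,6) C0_borel_measurable by auto
  obtain B where B: "B > 0" "\<And>x. \<bar>g x\<bar> \<le> B" using C0_bounded[OF assms(5)] by metis
  have "\<bar>w y * g u\<bar> \<le> 1 * B" for y u
    unfolding abs_mult using assms(7) B by (intro mult_mono) auto
  then show ?thesis
    by (intro MN.integrable_const_bound[of _ B]) (auto intro!: AE_I2)
qed

text \<open>The time integral is taken pointwise in \<open>x\<close>, not in the Banach space;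
  \<open>Pavg_riemann_limit\<close> recovers uniformity.\<close>

definition Pavg :: "(real \<Rightarrow> (real^'n) measure) \<Rightarrow> real \<Rightarrow> (real^'n \<Rightarrow> real) \<Rightarrow> real^'n \<Rightarrow> real" where
  "Pavg p s g x = integral {0..s} (\<lambda>u. Psg p u g x) / s"

context
  fixes p :: "real \<Rightarrow> (real^'n) measure"
  assumes sg: "conv_semigroup p"
begin

lemma semigroup_prob_space: "t \<ge> 0 \<Longrightarrow> prob_space (p t)"
  and semigroup_sets: "t \<ge> 0 \<Longrightarrow> sets (p t) = sets borel"
  using sg by (auto simp: conv_semigroup_def)

lemma Psg_integrable: "t \<ge> 0 \<Longrightarrow> C0 g \<Longrightarrow> integrable (p t) (\<lambda>z. g (z + x))"
  by (simp add: integrable_C0_shift semigroup_prob_space semigroup_sets)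

lemma Psg_0: "C0 g \<Longrightarrow> Psg p 0 g x = g x"
  using sg C0_borel_measurable[of g] by (simp add: Psg_def conv_semigroup_def integral_return)

lemma Psg_diff_le:
  assumes "t \<ge> 0" "C0 f" "C0 g" "\<And>x. \<bar>f x - g x\<bar> \<le> B"
  shows "\<bar>Psg p t f x - Psg p t g x\<bar> \<le> B"
proof -
  have "Psg p t f x - Psg p t g x = (\<integral>z. f (z + x) - g (z + x) \<partial>p t)"
    using assms by (simp add: Psg_def Psg_integrable)
  then show ?thesis
    using prob_space.abs_integral_le[OF semigroup_prob_space[OF assms(1)], of "\<lambda>z. f (z + x) - g (z + x)"] assms(4) by simp
qed

lemma Psg_add:
  assumes "s \<ge> 0" "t \<ge> 0" "C0 g"
  shows "Psg p (s + t) g x = (\<integral>y. Psg p t g (y + x) \<partial>p s)"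
    and "integrable (p s) (\<lambda>y. Psg p t g (y + x))"
proof -
  interpret S: prob_space "p s" by (rule semigroup_prob_space[OF assms(1)])
  interpret T: prob_space "p t" by (rule semigroup_prob_space[OF assms(2)])
  interpret ST: pair_prob_space "p s" "p t" ..
  note [measurable_cong] = semigroup_sets[OF assms(1)] semigroup_sets[OF assms(2)]
  have [measurable]: "g \<in> borel_measurable borel" by (rule C0_borel_measurable[OF assms(3)])
  have int: "integrable (p s \<Otimes>\<^sub>M p t) (\<lambda>(y, z). g (y + z + x))"
    using integrable_pair_C0[of "p s" "p t" g "\<lambda>_. 1" x] S.prob_space_axioms T.prob_space_axioms
      semigroup_sets assms by simp
  have "p (s + t) = convolution (p s) (p t)" using sg assms by (simp add: conv_semigroup_def)
  then have "Psg p (s + t) g x = (\<integral>q. g ((case q of (y, z) \<Rightarrow> y + z) + x) \<partial>(p s \<Otimes>\<^sub>M p t))"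
    unfolding Psg_def convolution_def by (simp add: integral_distr)
  also have "\<dots> = (\<integral>(y, z). g (y + z + x) \<partial>(p s \<Otimes>\<^sub>M p t))"
    by (simp add: split_beta')
  also have "\<dots> = (\<integral>y. (\<integral>z. g (y + z + x) \<partial>p t) \<partial>p s)"
    using ST.integral_fst[OF int] by simp
  also have "\<dots> = (\<integral>y. Psg p t g (y + x) \<partial>p s)"
    by (simp add: Psg_def add_ac)
  finally show "Psg p (s + t) g x = (\<integral>y. Psg p t g (y + x) \<partial>p s)" .
  show "integrable (p s) (\<lambda>y. Psg p t g (y + x))"
    using ST.integrable_fst[OF int] by (simp add: Psg_def add_ac)
qed

text \<open>Small z are handled by uniform continuity of \<open>g\<close>; the mass of
  \<open>p h\<close> away from 0 tends to 0 by weak convergence. Neither bound involves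
  \<open>x\<close>.\<close>

lemma Psg_uniform_at_0:
  assumes "C0 g" "e > 0"
  obtains d where "d > 0" "\<And>h x. 0 \<le> h \<Longrightarrow> h < d \<Longrightarrow> \<bar>Psg p h g x - g x\<bar> \<le> e"
proof -
  obtain B where B: "B > 0" "\<And>x. \<bar>g x\<bar> \<le> B" using C0_bounded[OF assms(1)] by metis
  obtain r where r: "r > 0" "\<And>x y. dist y x < r \<Longrightarrow> dist (g y) (g x) < e / 2"
    using C0_uniformly_continuous[OF assms(1)] assms(2)
    unfolding uniformly_continuous_on_def by (meson UNIV_I half_gt_zero)
  \<comment> \<open>A continuous substitute for the indicator of the complement of the ball of
    radius r, since weak convergence tests continuous functions only.\<close>
  define q :: "real^'n \<Rightarrow> real" where "q z = min 1 (norm z / r)" for z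
  have q01: "0 \<le> q z" "q z \<le> 1" for z using r(1) by (auto simp: q_def)
  have q_cont: "continuous_on UNIV q"
    unfolding q_def using r(1) by (intro continuous_intros) auto
  have bd: "\<bar>g (z + x) - g x\<bar> \<le> e / 2 + 2 * B * q z" for z x
  proof (cases "norm z < r")
    case True
    then have "\<bar>g (z + x) - g x\<bar> \<le> e / 2" using r(2)[of "z + x" x] by (simp add: dist_norm)
    moreover have "2 * B * q z \<ge> 0" using B q01 by simp
    ultimately show ?thesis by linarith
  next
    case False
    then have "q z = 1" using r(1) by (simp add: q_def)
    then show ?thesis using B(2)[of "z + x"] B(2)[of x] assms(2) by (simp add: abs_le_iff)
  qed
  have "bounded (range q)" using q01 by (auto simp: bounded_iff intro!: exI[of _ 1])
  then have "((\<lambda>t. \<integral>z. q z \<partial>p t) \<longlongrightarrow> q 0) (at_right 0)"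
    using sg q_cont by (auto simp: conv_semigroup_def)
  then have "eventually (\<lambda>t. dist (\<integral>z. q z \<partial>p t) (q 0) < e / (4 * B)) (at_right 0)"
    using assms(2) B(1) by (intro tendstoD) auto
  then obtain d where "d > 0" "\<And>h. 0 < h \<Longrightarrow> h < d \<Longrightarrow> dist (\<integral>z. q z \<partial>p h) (q 0) < e / (4 * B)"
    unfolding eventually_at_right_field by auto
  moreover have "q 0 = 0" by (simp add: q_def)
  ultimately have d: "d > 0" "\<And>h. 0 < h \<Longrightarrow> h < d \<Longrightarrow> (\<integral>z. q z \<partial>p h) < e / (4 * B)"
    by (auto simp: dist_real_def abs_less_iff)
  have "\<bar>Psg p h g x - g x\<bar> \<le> e" if h: "0 \<le> h" "h < d" for h x
  proof (cases "h = 0")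
    case True
    then show ?thesis using assms by (simp add: Psg_0)
  next
    case False
    interpret prob_space "p h" by (rule semigroup_prob_space[OF h(1)])
    note [measurable_cong] = semigroup_sets[OF h(1)]
    have [measurable]: "q \<in> borel_measurable borel" by (rule borel_measurable_continuous_onI[OF q_cont])
    have intq: "integrable (p h) q"
      by (rule integrable_const_bound[of _ 1]) (auto simp: q01)
    have intg: "integrable (p h) (\<lambda>z. g (z + x))" by (rule Psg_integrable[OF h(1) assms(1)])
    have "Psg p h g x - g x = (\<integral>z. g (z + x) - g x \<partial>p h)"
      using intg by (simp add: Psg_def prob_space)
    also have "\<bar>\<dots>\<bar> \<le> (\<integral>z. \<bar>g (z + x) - g x\<bar> \<partial>p h)" by (rule integral_abs_bound)
    also have "\<dots> \<le> (\<integral>z. e / 2 + 2 * B * q z \<partial>p h)"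
      using intg intq bd by (intro integral_mono) auto
    also have "\<dots> = e / 2 + 2 * B * (\<integral>z. q z \<partial>p h)" using intq by (simp add: prob_space)
    also have "\<dots> \<le> e / 2 + 2 * B * (e / (4 * B))"
      using d(2)[of h] h False B(1) by (intro add_left_mono mult_left_mono) auto
    also have "\<dots> = e" using B(1) by simp
    finally show ?thesis .
  qed
  with d(1) show thesis by (rule that)
qed

text \<open>By the semigroup law the difference is an average under \<open>p u\<close> of
  \<open>Psg p (v - u) g - g\<close>, so the modulus at time 0 works at every time.\<close>

lemma Psg_equicontinuous:
  assumes "C0 g" "e > 0"
  obtains d where "d > 0"
    "\<And>u v x. 0 \<le> u \<Longrightarrow> u \<le> v \<Longrightarrow> v < u + d \<Longrightarrow> \<bar>Psg p v g x - Psg p u g x\<bar> \<le> e"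
proof -
  obtain d where d: "d > 0" "\<And>h x. 0 \<le> h \<Longrightarrow> h < d \<Longrightarrow> \<bar>Psg p h g x - g x\<bar> \<le> e"
    using Psg_uniform_at_0[OF assms] by metis
  have "\<bar>Psg p v g x - Psg p u g x\<bar> \<le> e" if "0 \<le> u" "u \<le> v" "v < u + d" for u v x
  proof -
    interpret prob_space "p u" by (rule semigroup_prob_space[OF that(1)])
    have "Psg p v g x - Psg p u g x = (\<integral>y. Psg p (v - u) g (y + x) - g (y + x) \<partial>p u)"
      using Psg_add[of u "v - u" g x] that Psg_integrable[OF that(1) assms(1), of x] assms(1)
      by (simp add: Psg_def[of p u])
    then show ?thesis using abs_integral_le[of "\<lambda>y. Psg p (v - u) g (y + x) - g (y + x)" e] d(2) that by simp
  qed
  with d(1) show thesis by (rule that)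
qed

lemma Psg_continuous_on:
  assumes "C0 g"
  shows "continuous_on {0..} (\<lambda>u. Psg p u g x)"
  unfolding continuous_on_iff
proof (intro ballI allI impI)
  fix u e :: real assume "u \<in> {0..}" "e > 0"
  obtain d where d: "d > 0"
    "\<And>u v x. 0 \<le> u \<Longrightarrow> u \<le> v \<Longrightarrow> v < u + d \<Longrightarrow> \<bar>Psg p v g x - Psg p u g x\<bar> \<le> e / 2"
    using Psg_equicontinuous[OF assms, of "e / 2"] \<open>e > 0\<close> by auto
  have "dist (Psg p v g x) (Psg p u g x) < e" if "v \<in> {0..}" "dist v u < d" for v
    using d(2)[of u v x] d(2)[of v u x] that \<open>u \<in> {0..}\<close> \<open>e > 0\<close>
    by (cases "u \<le> v") (auto simp: dist_real_def abs_minus_commute)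
  with d(1) show "\<exists>d>0. \<forall>v\<in>{0..}. dist v u < d \<longrightarrow> dist (Psg p v g x) (Psg p u g x) < e" by blast
qed

lemma Psg_integrable_on: "C0 g \<Longrightarrow> a \<ge> 0 \<Longrightarrow> (\<lambda>u. Psg p u g x) integrable_on {a..b}"
  by (intro integrable_continuous_real continuous_on_subset[OF Psg_continuous_on]) auto

lemma Pavg_diff_le:
  assumes "s > 0" "C0 f" "C0 g" "\<And>x. \<bar>f x - g x\<bar> \<le> B"
  shows "\<bar>Pavg p s f x - Pavg p s g x\<bar> \<le> B"
proof -
  have "norm (integral {0..s} (\<lambda>u. Psg p u f x - Psg p u g x)) \<le> B * (s - 0)"
    using assms Psg_diff_le
    by (intro integral_bound continuous_intros continuous_on_subset[OF Psg_continuous_on]) auto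
  then show ?thesis using assms(1-3)
    by (simp add: Pavg_def integral_diff Psg_integrable_on diff_divide_distrib[symmetric] field_simps)
qed

lemma Pavg_uniform_limit:
  assumes "C0 g"
  shows "uniform_limit UNIV (\<lambda>s x. Pavg p s g x) g (at_right 0)"
proof (rule uniform_limitI)
  fix e :: real assume "e > 0"
  then obtain d where d: "d > 0" "\<And>h x. 0 \<le> h \<Longrightarrow> h < d \<Longrightarrow> \<bar>Psg p h g x - g x\<bar> \<le> e / 2"
    using Psg_uniform_at_0[OF assms, of "e / 2"] by auto
  have "dist (Pavg p s g x) (g x) < e" if s: "0 < s" "s < d" for s x
  proof -
    have "norm (integral {0..s} (\<lambda>u. Psg p u g x - g x)) \<le> e / 2 * (s - 0)"
      using s assms d(2)
      by (intro integral_bound continuous_intros continuous_on_subset[OF Psg_continuous_on]) auto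
    moreover have "integral {0..s} (\<lambda>u. Psg p u g x - g x) = s * (Pavg p s g x - g x)"
      using s Henstock_Kurzweil_Integration.integral_diff[OF Psg_integrable_on[OF assms, of 0 x s] integrable_const_ivl[of "g x"]]
      by (simp add: Pavg_def right_diff_distrib)
    ultimately have "\<bar>Pavg p s g x - g x\<bar> * s \<le> e / 2 * s" using s by (simp add: abs_mult mult.commute)
    then have "\<bar>Pavg p s g x - g x\<bar> \<le> e / 2" using s by simp
    then show ?thesis using \<open>e > 0\<close> by (simp add: dist_real_def)
  qed
  then show "\<forall>\<^sub>F s in at_right 0. \<forall>x\<in>UNIV. dist (Pavg p s g x) (g x) < e"
    using d(1) by (auto simp: eventually_at_right_field)
qed

text \<open>Exhibits the average as a limit of finite linear combinations, to which linearity and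
  closedness of an operator apply. Equicontinuity in time makes the error uniform in
  \<open>x\<close>.\<close>

lemma Pavg_riemann_limit:
  assumes "C0 g" "s > 0"
  shows "uniform_limit UNIV (\<lambda>n x. (1 / real (Suc n)) * (\<Sum>k<Suc n. Psg p (real k * (s / real (Suc n))) g x))
    (Pavg p s g) sequentially"
  unfolding uniform_limit_sequentially_iff
proof (intro allI impI)
  fix e :: real assume e: "e > 0"
  then obtain d where d: "d > 0"
    "\<And>u v x. 0 \<le> u \<Longrightarrow> u \<le> v \<Longrightarrow> v < u + d \<Longrightarrow> \<bar>Psg p v g x - Psg p u g x\<bar> \<le> e / 2"
    using Psg_equicontinuous[OF assms(1), of "e / 2"] by auto
  obtain N where N: "s / d < real N" using reals_Archimedean2 by blast
  have "dist ((1 / real (Suc n)) * (\<Sum>k<Suc n. Psg p (real k * (s / real (Suc n))) g x)) (Pavg p s g x) < e"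
    if n: "n \<ge> N" for n x
  proof -
    define m where "m = Suc n"
    define \<delta> where "\<delta> = s / real m"
    define S where "S = (\<Sum>k<m. Psg p (real k * \<delta>) g x)"
    have m: "real m > 0" by (simp add: m_def)
    have "s / d < real m" using N n by (simp add: m_def)
    then have \<delta>: "\<delta> < d" "\<delta> > 0" "real m * \<delta> = s"
      using m d(1) assms(2) by (auto simp: \<delta>_def field_simps)
    have "\<bar>integral {0..real m * \<delta>} (\<lambda>u. Psg p u g x) - \<delta> * S\<bar> \<le> real m * \<delta> * (e / 2)"
      unfolding S_def
      using \<delta> by (intro integral_riemann_sum_error Psg_continuous_on assms(1) d(2)) auto
    then have "\<bar>s * Pavg p s g x - s * ((1 / real m) * S)\<bar> \<le> s * (e / 2)"
      unfolding \<delta>(3) using assms(2) by (simp add: Pavg_def \<delta>_def)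
    then have "s * \<bar>Pavg p s g x - (1 / real m) * S\<bar> \<le> s * (e / 2)"
      unfolding right_diff_distrib[symmetric] using assms(2) by (simp only: abs_mult abs_of_pos)
    then have "\<bar>Pavg p s g x - (1 / real m) * S\<bar> \<le> e / 2" using assms(2) by simp
    then have "dist ((1 / real m) * S) (Pavg p s g x) < e"
      using e unfolding dist_real_def by linarith
    then show ?thesis unfolding S_def \<delta>_def m_def .
  qed
  then show "\<exists>N. \<forall>n\<ge>N. \<forall>x\<in>UNIV. dist ((1 / real (Suc n)) * (\<Sum>k<Suc n. Psg p (real k * (s / real (Suc n))) g x))
     (Pavg p s g x) < e" by blast
qed

lemma Psg_uniform_limit:
  assumes "t \<ge> 0" "\<And>n. C0 (F n)" "C0 f" "uniform_limit UNIV F f sequentially"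
  shows "uniform_limit UNIV (\<lambda>n. Psg p t (F n)) (Psg p t f) sequentially"
proof (rule uniform_limitI)
  fix e :: real assume e: "e > 0"
  have "\<forall>\<^sub>F n in sequentially. \<forall>x\<in>UNIV. dist (F n x) (f x) < e / 2"
    using uniform_limitD[OF assms(4), of "e / 2"] e by simp
  then show "\<forall>\<^sub>F n in sequentially. \<forall>x\<in>UNIV. dist (Psg p t (F n) x) (Psg p t f x) < e"
  proof eventually_elim
    case (elim n)
    then have "\<bar>Psg p t (F n) x - Psg p t f x\<bar> \<le> e / 2" for x
      using assms by (intro Psg_diff_le) (auto simp: dist_real_def less_imp_le)
    then show ?case using e by (smt (verit) dist_real_def field_sum_of_halves)
  qed
qed

lemma Pavg_uniform_limit_fun:
  assumes "s > 0" "\<And>n. C0 (F n)" "C0 f" "uniform_limit UNIV F f sequentially"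
  shows "uniform_limit UNIV (\<lambda>n. Pavg p s (F n)) (Pavg p s f) sequentially"
proof (rule uniform_limitI)
  fix e :: real assume e: "e > 0"
  have "\<forall>\<^sub>F n in sequentially. \<forall>x\<in>UNIV. dist (F n x) (f x) < e / 2"
    using uniform_limitD[OF assms(4), of "e / 2"] e by simp
  then show "\<forall>\<^sub>F n in sequentially. \<forall>x\<in>UNIV. dist (Pavg p s (F n) x) (Pavg p s f x) < e"
  proof eventually_elim
    case (elim n)
    then have "\<bar>Pavg p s (F n) x - Pavg p s f x\<bar> \<le> e / 2" for x
      using assms by (intro Pavg_diff_le) (auto simp: dist_real_def less_imp_le)
    then show ?case using e by (smt (verit) dist_real_def field_sum_of_halves)
  qed
qed

lemma Psg_wconv:
  assumes "t \<ge> 0" "prob_space \<nu>" "sets \<nu> = sets borel" "C0 f"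
    "w \<in> borel_measurable borel" "\<And>z. \<bar>w z\<bar> \<le> 1"
  shows "Psg p t (wconv \<nu> w f) x = wconv \<nu> w (Psg p t f) x"
    and "integrable \<nu> (\<lambda>y. w y * Psg p t f (y + x))"
proof -
  interpret N: prob_space \<nu> by fact
  interpret T: prob_space "p t" by (rule semigroup_prob_space[OF assms(1)])
  interpret NT: pair_prob_space \<nu> "p t" ..
  have int: "integrable (\<nu> \<Otimes>\<^sub>M p t) (\<lambda>(y, z). w y * f (y + z + x))"
    by (rule integrable_pair_C0[OF assms(2) T.prob_space_axioms assms(3) semigroup_sets[OF assms(1)] assms(4-6)])
  have "Psg p t (wconv \<nu> w f) x = (\<integral>z. (\<integral>y. w y * f (y + z + x) \<partial>\<nu>) \<partial>p t)"
    by (simp add: Psg_def wconv_def add_ac)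
  also have "\<dots> = (\<integral>y. (\<integral>z. w y * f (y + z + x) \<partial>p t) \<partial>\<nu>)"
    by (rule NT.Fubini_integral[OF int])
  also have "\<dots> = wconv \<nu> w (Psg p t f) x"
    by (simp add: Psg_def wconv_def add_ac)
  finally show "Psg p t (wconv \<nu> w f) x = wconv \<nu> w (Psg p t f) x" .
  show "integrable \<nu> (\<lambda>y. w y * Psg p t f (y + x))"
    using NT.integrable_fst[OF int] by (simp add: Psg_def add_ac)
qed

text \<open>The error is at most sup |f| times the mass of \<open>p u\<close> outside the ball,
  which does not depend on \<open>x\<close> and tends to 0.\<close>

lemma wconv_truncation_limit:
  assumes "u \<ge> 0" "C0 f"
  shows "uniform_limit UNIV (\<lambda>n. wconv (p u) (indicator (cball 0 (real n))) f) (Psg p u f) sequentially"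
proof (rule uniform_limitI)
  fix e :: real assume e: "e > 0"
  interpret prob_space "p u" by (rule semigroup_prob_space[OF assms(1)])
  note sets = semigroup_sets[OF assms(1)]
  note [measurable_cong] = sets
  obtain B where B: "B > 0" "\<And>x. \<bar>f x\<bar> \<le> B" using C0_bounded[OF assms(2)] by metis
  have "(\<lambda>n. prob (cball 0 (real n))) \<longlonglongrightarrow> prob (\<Union>n. cball 0 (real n))"
    by (rule finite_Lim_measure_incseq) (auto simp: sets incseq_def)
  moreover have "(\<Union>n. cball 0 (real n)) = space (p u)"
    using sets_eq_imp_space_eq[OF sets] by (auto intro: real_arch_simple)
  ultimately have "(\<lambda>n. prob (cball 0 (real n))) \<longlonglongrightarrow> 1" by (simp add: prob_space)
  then have "\<forall>\<^sub>F n in sequentially. dist (prob (cball 0 (real n))) 1 < e / B"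
    using e B(1) by (intro tendstoD) auto
  then show "\<forall>\<^sub>F n in sequentially. \<forall>x\<in>UNIV. dist (wconv (p u) (indicator (cball 0 (real n))) f x) (Psg p u f x) < e"
  proof eventually_elim
    case (elim n)
    let ?w = "indicator (cball 0 (real n)) :: real^'n \<Rightarrow> real"
    have w: "integrable (p u) ?w" by (rule integrable_const_bound[of _ 1]) (auto simp: sets intro!: borel_measurable_indicator)
    have "dist (wconv (p u) ?w f x) (Psg p u f x) < e" for x
    proof -
      have i1: "integrable (p u) (\<lambda>z. ?w z * f (z + x))" by (rule integrable_wconv[OF sets w assms(2)])
      have i2: "integrable (p u) (\<lambda>z. f (z + x))" by (rule Psg_integrable[OF assms])
      have "Psg p u f x - wconv (p u) ?w f x = (\<integral>z. f (z + x) - ?w z * f (z + x) \<partial>p u)"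
        using i1 i2 by (simp add: Psg_def wconv_def)
      also have "\<bar>\<dots>\<bar> \<le> (\<integral>z. \<bar>f (z + x) - ?w z * f (z + x)\<bar> \<partial>p u)" by (rule integral_abs_bound)
      also have "\<dots> \<le> (\<integral>z. B * (1 - ?w z) \<partial>p u)"
      proof (rule integral_mono)
        show "integrable (p u) (\<lambda>z. \<bar>f (z + x) - ?w z * f (z + x)\<bar>)" using i1 i2 by simp
        show "integrable (p u) (\<lambda>z. B * (1 - ?w z))" using w by simp
        show "\<bar>f (z + x) - ?w z * f (z + x)\<bar> \<le> B * (1 - ?w z)" for z
          using B by (simp split: split_indicator)
      qed
      also have "\<dots> = B * (1 - prob (cball 0 (real n)))"
        using w by (simp add: prob_space right_diff_distrib sets)
      also have "\<dots> < B * (e / B)"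
        using elim B(1) by (intro mult_strict_left_mono) (auto simp: dist_real_def)
      finally show ?thesis using B(1) by (simp add: dist_real_def abs_minus_commute)
    qed
    then show ?case by blast
  qed
qed

end

section \<open>Identification of the generator\<close>

context
  fixes p :: "real \<Rightarrow> (real^'n) measure"
    and D :: "(real^'n \<Rightarrow> real) set"
    and A :: "(real^'n \<Rightarrow> real) \<Rightarrow> (real^'n \<Rightarrow> real)"
  assumes sg: "conv_semigroup p"
    and lin: "lin_op D A"
    and closed: "closed_op D A"
    and core: "is_core {f. test_fun f} D A"
    and weak: "\<And>s x \<phi>. test_fun \<phi> \<Longrightarrow>
           (LINT u:{s..}|lborel.
              (\<integral>z. deriv (\<lambda>v. \<phi> (v, x + z)) u + A (\<lambda>y. \<phi> (u, y)) (x + z) \<partial>p (u - s)))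
           = - \<phi> (s, x)"
begin

lemma domain_C0: "f \<in> D \<Longrightarrow> C0 f" "f \<in> D \<Longrightarrow> C0 (A f)"
  using lin by (auto simp: lin_op_def)

lemma test_fun_in_domain: "test_fun f \<Longrightarrow> f \<in> D"
  using core by (auto simp: is_core_def)

lemma closed_opD:
  assumes "\<And>n. F n \<in> D" "uniform_limit UNIV F f sequentially"
    "uniform_limit UNIV (\<lambda>n. A (F n)) g sequentially"
  shows "f \<in> D" "A f = g"
  using closed assms unfolding closed_op_def by blast+

lemma domain_scale: "f \<in> D \<Longrightarrow> (\<lambda>x. c * f x) \<in> D" "f \<in> D \<Longrightarrow> A (\<lambda>x. c * f x) = (\<lambda>x. c * A f x)"
  using lin by (auto simp: lin_op_def)

lemma domain_add:
  "f \<in> D \<Longrightarrow> g \<in> D \<Longrightarrow> (\<lambda>x. f x + g x) \<in> D"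
  "f \<in> D \<Longrightarrow> g \<in> D \<Longrightarrow> A (\<lambda>x. f x + g x) = (\<lambda>x. A f x + A g x)"
  using lin by (auto simp: lin_op_def)

lemma domain_scale_sum:
  assumes "\<And>k. F k \<in> D"
  shows "(\<lambda>x. c * (\<Sum>k<m. F k x)) \<in> D \<and> A (\<lambda>x. c * (\<Sum>k<m. F k x)) = (\<lambda>x. c * (\<Sum>k<(m::nat). A (F k) x))"
proof -
  have zero: "(\<lambda>x. 0) \<in> D" using lin by (simp add: lin_op_def)
  have A_zero: "A (\<lambda>x. 0) = (\<lambda>x. 0)" using domain_scale(2)[OF zero, of 0] by simp
  have "(\<lambda>x. \<Sum>k<m. F k x) \<in> D \<and> A (\<lambda>x. \<Sum>k<m. F k x) = (\<lambda>x. \<Sum>k<m. A (F k) x)"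
    using assms by (induction m) (simp_all add: zero A_zero domain_add)
  then show ?thesis by (simp add: domain_scale)
qed

section \<open>The operator is a restriction of the generator\<close>

lemma Psg_test_fun_eq_integral:
  assumes f: "test_fun f" and t: "t \<ge> 0"
  shows "Psg p t f x - f x = integral {0..t} (\<lambda>u. Psg p u (A f) x)"
proof -
  have C0: "C0 f" "C0 (A f)" using domain_C0 test_fun_in_domain[OF f] by auto
  have "(LINT u:{0..}|lborel. deriv \<eta> u * Psg p u f x + \<eta> u * Psg p u (A f) x) = - \<eta> 0 * Psg p 0 f x"
    if \<eta>: "test_fun \<eta>" for \<eta> :: "real \<Rightarrow> real"
  proof -
    have "(\<integral>z. deriv (\<lambda>v. \<eta> v * f (x + z)) u + A (\<lambda>y. \<eta> u * f y) (x + z) \<partial>p u) =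
        deriv \<eta> u * Psg p u f x + \<eta> u * Psg p u (A f) x" if u: "u \<ge> 0" for u
    proof -
      have "\<eta> field_differentiable at u"
        using smooth_has_real_derivative(1)[of \<eta> u] \<eta> by (auto simp: test_fun_def field_differentiable_def)
      then have d: "deriv (\<lambda>v. \<eta> v * f (x + z)) u = deriv \<eta> u * f (z + x)" for z
        by (simp add: deriv_cmult_right add.commute)
      have A: "A (\<lambda>y. \<eta> u * f y) = (\<lambda>y. \<eta> u * A f y)"
        by (rule domain_scale(2)[OF test_fun_in_domain[OF f]])
      show ?thesis
        unfolding d A Psg_def using Psg_integrable[OF sg u] C0 by (simp add: add.commute[of x])
    qed
    then have "(LINT u:{0..}|lborel. deriv \<eta> u * Psg p u f x + \<eta> u * Psg p u (A f) x) =
      (LINT u:{0..}|lborel. (\<integral>z. deriv (\<lambda>v. \<eta> v * f (x + z)) u + A (\<lambda>y. \<eta> u * f y) (x + z) \<partial>p u))"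
      unfolding set_lebesgue_integral_def by (intro Bochner_Integration.integral_cong) (auto simp: indicator_def)
    also have "\<dots> = - (\<eta> 0 * f x)"
      \<comment> \<open>The hypothesis at starting time 0, where the measure at time u is
        \<open>p u\<close>.\<close>
      using weak[OF test_fun_prod[OF \<eta> f], of 0 x] by simp
    finally show ?thesis using Psg_0[OF sg C0(1)] by simp
  qed
  from weak_derivative_half_line[OF Psg_continuous_on[OF sg C0(1)] Psg_continuous_on[OF sg C0(2)] this t]
  show ?thesis using Psg_0[OF sg C0(1)] by simp
qed

text \<open>For fixed \<open>t\<close> and \<open>x\<close> both sides are continuous in
  \<open>f\<close> for the graph norm, so the identity passes from the core to
  \<open>D\<close>.\<close>

lemma Psg_difference_quotient:
  assumes f: "f \<in> D" and t: "t > 0"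
  shows "(Psg p t f x - f x) / t = Pavg p t (A f) x"
proof -
  obtain F where F: "\<And>n. test_fun (F n)" "uniform_limit UNIV F f sequentially"
    "uniform_limit UNIV (\<lambda>n. A (F n)) (A f) sequentially"
    using core f unfolding is_core_def by blast
  have FD: "F n \<in> D" for n by (rule test_fun_in_domain[OF F(1)])
  have eq: "(Psg p t (F n) x - F n x) / t = Pavg p t (A (F n)) x" for n
    using Psg_test_fun_eq_integral[OF F(1)] t by (simp add: Pavg_def)
  have "(\<lambda>n. Psg p t (F n) x) \<longlonglongrightarrow> Psg p t f x"
    using Psg_uniform_limit[OF sg _ _ _ F(2)] domain_C0 FD f t by (intro tendsto_uniform_limitI[where S = UNIV]) auto
  moreover have "(\<lambda>n. F n x) \<longlonglongrightarrow> f x" using F(2) by (rule tendsto_uniform_limitI) simp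
  ultimately have "(\<lambda>n. (Psg p t (F n) x - F n x) / t) \<longlonglongrightarrow> (Psg p t f x - f x) / t"
    using t by (intro tendsto_intros) auto
  moreover have "(\<lambda>n. Pavg p t (A (F n)) x) \<longlonglongrightarrow> Pavg p t (A f) x"
    using Pavg_uniform_limit_fun[OF sg t _ _ F(3)] domain_C0 FD f by (intro tendsto_uniform_limitI[where S = UNIV]) auto
  ultimately show ?thesis unfolding eq by (rule LIMSEQ_unique)
qed

lemma gen_domain:
  assumes "f \<in> D"
  shows "gen p f (A f)"
proof -
  have "uniform_limit UNIV (\<lambda>t x. Pavg p t (A f) x) (A f) (at_right 0)"
    by (rule Pavg_uniform_limit[OF sg domain_C0(2)[OF assms]])
  moreover have "\<forall>\<^sub>F t in at_right 0. \<forall>x\<in>UNIV. Pavg p t (A f) x = (Psg p t f x - f x) / t"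
    using eventually_at_right_less[of "0::real"]
    by eventually_elim (simp add: Psg_difference_quotient[OF assms])
  ultimately have "uniform_limit UNIV (\<lambda>t x. (Psg p t f x - f x) / t) (A f) (at_right 0)"
    by (subst (asm) uniform_limit_cong[where g = "\<lambda>t x. (Psg p t f x - f x) / t" and i = "A f"]) auto
  then show ?thesis using domain_C0[OF assms] by (simp add: gen_def)
qed

section \<open>Invariance of the domain under the semigroup and its averages\<close>

text \<open>Cutting \<open>p u\<close> off to a ball keeps the convolution a test function, hence in the domain.\<close>

lemma A_wconv_truncated:
  assumes f: "test_fun f" and u: "u \<ge> 0"
  shows "test_fun (wconv (p u) (indicator (cball 0 R)) f)"
    and "A (wconv (p u) (indicator (cball 0 R)) f) = wconv (p u) (indicator (cball 0 R)) (A f)"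
proof -
  let ?w = "indicator (cball 0 R) :: real^'n \<Rightarrow> real"
  interpret prob_space "p u" by (rule semigroup_prob_space[OF sg u])
  note sets = semigroup_sets[OF sg u]
  note [measurable_cong] = sets
  have w: "integrable (p u) ?w" by (rule integrable_const_bound[of _ 1]) (auto simp: sets intro!: borel_measurable_indicator)
  have C0: "C0 f" "C0 (A f)" using domain_C0 test_fun_in_domain[OF f] by auto
  show test: "test_fun (wconv (p u) ?w f)"
    by (rule test_fun_wconv[OF sets w f, of R]) (auto simp: indicator_def)
  show "A (wconv (p u) ?w f) = wconv (p u) ?w (A f)"
  proof
    fix x
    \<comment> \<open>On test functions \<open>A\<close> is the limit of difference quotients, so it
      suffices to compute this limit a second time with the convolution moved outside.\<close>
    have "((\<lambda>t. (Psg p t (wconv (p u) ?w f) x - wconv (p u) ?w f x) / t) \<longlongrightarrow> A (wconv (p u) ?w f) x) (at_right 0)"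
      using gen_domain[OF test_fun_in_domain[OF test]] unfolding gen_def
      by (intro tendsto_uniform_limitI[where S = UNIV]) auto
    moreover have "((\<lambda>t. (Psg p t (wconv (p u) ?w f) x - wconv (p u) ?w f x) / t) \<longlongrightarrow> wconv (p u) ?w (A f) x) (at_right 0)"
    proof (rule tendstoI)
      fix e :: real assume e: "e > 0"
      have "\<forall>\<^sub>F t in at_right 0. \<forall>x\<in>UNIV. dist ((Psg p t f x - f x) / t) (A f x) < e / 2"
        using gen_domain[OF test_fun_in_domain[OF f]] e unfolding gen_def by (intro uniform_limitD) auto
      then show "\<forall>\<^sub>F t in at_right 0.
          dist ((Psg p t (wconv (p u) ?w f) x - wconv (p u) ?w f x) / t) (wconv (p u) ?w (A f) x) < e"
        using eventually_at_right_less[of "0::real"]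
      proof eventually_elim
        case (elim t)
        \<comment> \<open>The defect of the difference quotient of \<open>f\<close> is uniformly
          small, and integrating it against a weight between 0 and 1 under a probability measure
          keeps it so.\<close>
        define r where "r y = (Psg p t f y - f y) / t - A f y" for y
        have r: "\<bar>r y\<bar> \<le> e / 2" for y using elim(1) by (simp add: r_def dist_real_def less_imp_le)
        have Pw: "Psg p t (wconv (p u) ?w f) x = wconv (p u) ?w (Psg p t f) x"
          "integrable (p u) (\<lambda>y. ?w y * Psg p t f (y + x))"
          using elim(2) by (auto intro!: Psg_wconv[OF sg] prob_space_axioms sets C0 borel_measurable_indicator)
        have eq: "?w y * r (y + x) = (?w y * Psg p t f (y + x) - ?w y * f (y + x)) / t - ?w y * A f (y + x)" for y
          by (simp add: r_def right_diff_distrib diff_divide_distrib)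
        have "(Psg p t (wconv (p u) ?w f) x - wconv (p u) ?w f x) / t - wconv (p u) ?w (A f) x =
          (\<integral>y. ?w y * r (y + x) \<partial>p u)"
          unfolding Pw(1) eq using Pw(2) integrable_wconv[OF sets w C0(1), of x] integrable_wconv[OF sets w C0(2), of x]
          by (simp add: wconv_def)
        moreover have "\<bar>\<integral>y. ?w y * r (y + x) \<partial>p u\<bar> \<le> e / 2"
          using r e by (intro abs_integral_le) (auto simp: indicator_def)
        ultimately show ?case using e by (simp add: dist_real_def)
      qed
    qed
    ultimately show "A (wconv (p u) ?w f) x = wconv (p u) ?w (A f) x"
      by (rule tendsto_unique[OF trivial_limit_at_right_real])
  qed
qed

text \<open>\<open>Psg p u f\<close> need not have compact support. The truncated convolutions are
  test functions, and both they and their images under \<open>A\<close> converge uniformly.\<close>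

lemma Psg_test_fun_in_domain:
  assumes f: "test_fun f" and u: "u \<ge> 0"
  shows "Psg p u f \<in> D" "A (Psg p u f) = Psg p u (A f)"
proof -
  have C0: "C0 f" "C0 (A f)" using domain_C0 test_fun_in_domain[OF f] by auto
  have "wconv (p u) (indicator (cball 0 (real n))) f \<in> D" for n
    using A_wconv_truncated(1)[OF assms] by (rule test_fun_in_domain)
  moreover note wconv_truncation_limit[OF sg u C0(1)]
  moreover have "uniform_limit UNIV (\<lambda>n. A (wconv (p u) (indicator (cball 0 (real n))) f)) (Psg p u (A f)) sequentially"
    unfolding A_wconv_truncated(2)[OF assms] by (rule wconv_truncation_limit[OF sg u C0(2)])
  ultimately show "Psg p u f \<in> D" "A (Psg p u f) = Psg p u (A f)" by (rule closed_opD)+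
qed

lemma Pavg_test_fun_in_domain:
  assumes f: "test_fun f" and s: "s > 0"
  shows "Pavg p s f \<in> D" "A (Pavg p s f) = Pavg p s (A f)"
proof -
  have C0: "C0 f" "C0 (A f)" using domain_C0 test_fun_in_domain[OF f] by auto
  define F where "F n k = Psg p (real k * (s / real (Suc n))) f" for n k
  have F: "F n k \<in> D" "A (F n k) = Psg p (real k * (s / real (Suc n))) (A f)" for n k
    unfolding F_def using s by (auto intro!: Psg_test_fun_in_domain[OF f])
  have S: "(\<lambda>x. 1 / real (Suc n) * (\<Sum>k<Suc n. F n k x)) \<in> D"
    "A (\<lambda>x. 1 / real (Suc n) * (\<Sum>k<Suc n. F n k x)) =
      (\<lambda>x. 1 / real (Suc n) * (\<Sum>k<Suc n. Psg p (real k * (s / real (Suc n))) (A f) x))" for n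
    using domain_scale_sum[of "F n" "1 / real (Suc n)" "Suc n", OF F(1)] unfolding F(2) by blast+
  have "uniform_limit UNIV (\<lambda>n x. 1 / real (Suc n) * (\<Sum>k<Suc n. F n k x)) (Pavg p s f) sequentially"
    unfolding F_def by (rule Pavg_riemann_limit[OF sg C0(1) s])
  moreover have "uniform_limit UNIV (\<lambda>n. A (\<lambda>x. 1 / real (Suc n) * (\<Sum>k<Suc n. F n k x))) (Pavg p s (A f)) sequentially"
    unfolding S(2) by (rule Pavg_riemann_limit[OF sg C0(2) s])
  ultimately show "Pavg p s f \<in> D" "A (Pavg p s f) = Pavg p s (A f)"
    by (rule closed_opD[OF S(1)])+
qed

text \<open>For test functions, \<open>A\<close> maps the averages to difference quotients, in which
  \<open>A\<close> no longer occurs. Uniform approximation of \<open>f\<close> therefore suffices,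
  with no control of \<open>A (F n)\<close>.\<close>

lemma Pavg_in_domain:
  assumes f: "C0 f" and s: "s > 0"
  shows "Pavg p s f \<in> D" "A (Pavg p s f) = (\<lambda>x. (Psg p s f x - f x) / s)"
proof -
  have "\<exists>g. test_fun g \<and> (\<forall>x. \<bar>g x - f x\<bar> \<le> 1 / real (Suc n))" for n
    using test_fun_dense_C0[OF f, of "1 / real (Suc n)"] by (metis of_nat_0_less_iff zero_less_Suc zero_less_divide_1_iff)
  then obtain F where F: "\<And>n. test_fun (F n)" "\<And>n x. \<bar>F n x - f x\<bar> \<le> 1 / real (Suc n)" by metis
  have FC0: "C0 (F n)" for n by (rule test_fun_C0[OF F(1)])
  have lim: "uniform_limit UNIV F f sequentially"
  proof (rule uniform_limitI)
    fix e :: real assume "e > 0"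
    then have "\<forall>\<^sub>F n in sequentially. dist (1 / real (Suc n)) 0 < e"
      using LIMSEQ_inverse_real_of_nat by (intro tendstoD) (auto simp: inverse_eq_divide)
    then show "\<forall>\<^sub>F n in sequentially. \<forall>x\<in>UNIV. dist (F n x) (f x) < e"
    proof eventually_elim
      case (elim n)
      then have "1 / real (Suc n) < e" by (simp add: dist_real_def)
      with F(2)[of n] show ?case unfolding dist_real_def by (meson le_less_trans)
    qed
  qed
  have "uniform_limit UNIV (\<lambda>n x. inverse s * (Psg p s (F n) x - F n x)) (\<lambda>x. inverse s * (Psg p s f x - f x)) sequentially"
    using Psg_uniform_limit[OF sg less_imp_le[OF s] FC0 f lim] lim
    by (intro uniform_limit_intros)
  moreover have "(\<lambda>x. inverse s * (Psg p s (F n) x - F n x)) = A (Pavg p s (F n))" for n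
    using Psg_difference_quotient[OF test_fun_in_domain[OF F(1)] s, of n]
    by (simp add: Pavg_test_fun_in_domain[OF F(1) s] fun_eq_iff divide_inverse mult.commute)
  ultimately have "uniform_limit UNIV (\<lambda>n. A (Pavg p s (F n))) (\<lambda>x. (Psg p s f x - f x) / s) sequentially"
    by (simp add: divide_inverse mult.commute)
  then show "Pavg p s f \<in> D" "A (Pavg p s f) = (\<lambda>x. (Psg p s f x - f x) / s)"
    by (rule closed_opD[OF Pavg_test_fun_in_domain(1)[OF F(1) s] Pavg_uniform_limit_fun[OF sg s FC0 f lim]])+
qed

text \<open>Short-time averages of \<open>f\<close> lie in \<open>D\<close> and tend to
  \<open>f\<close>; \<open>A\<close> maps them to difference quotients, which tend to
  \<open>g\<close> because \<open>f\<close> is in the domain of the generator.\<close>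

lemma generator_domain_subset:
  assumes "gen p f g"
  shows "f \<in> D"
proof -
  have f: "C0 f" using assms by (simp add: gen_def)
  \<comment> \<open>\<open>closed_op\<close> speaks of sequences, so the limit s -> 0 is taken along
    1/(n + 1).\<close>
  have s: "filterlim (\<lambda>n. inverse (real (Suc n))) (at_right 0) sequentially"
    by (rule tendsto_imp_filterlim_at_right[OF LIMSEQ_inverse_real_of_nat]) auto
  have lim: "uniform_limit UNIV (\<lambda>n. Pavg p (inverse (real (Suc n))) f) f sequentially"
    by (rule filterlim_compose[OF Pavg_uniform_limit[OF sg f] s])
  have lim_A: "uniform_limit UNIV (\<lambda>n. A (Pavg p (inverse (real (Suc n))) f)) g sequentially"
  proof -
    have "A (Pavg p (inverse (real (Suc n))) f) =
        (\<lambda>x. (Psg p (inverse (real (Suc n))) f x - f x) / inverse (real (Suc n)))" for n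
      by (rule Pavg_in_domain(2)[OF f]) simp
    then show ?thesis
      using filterlim_compose[OF conjunct2[OF conjunct2[OF assms[unfolded gen_def]]] s] by simp
  qed
  have "Pavg p (inverse (real (Suc n))) f \<in> D" for n
    by (rule Pavg_in_domain(1)[OF f]) simp
  then show ?thesis by (rule closed_opD(1)[OF _ lim lim_A])
qed

end

theorem theorem4p6:
  fixes p :: "real \<Rightarrow> (real^'n) measure"
    and D :: "(real^'n \<Rightarrow> real) set"
    and A :: "(real^'n \<Rightarrow> real) \<Rightarrow> (real^'n \<Rightarrow> real)"
  assumes "conv_semigroup p"
    and "lin_op D A"
    and "closed_op D A"
    and "is_core {f. test_fun f} D A"
    and "\<forall>s::real. \<forall>x::real^'n. \<forall>\<phi>::real \<times> (real^'n) \<Rightarrow> real. test_fun \<phi> \<longrightarrow>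
           (LINT u:{s..}|lborel.
              (\<integral>z. deriv (\<lambda>v. \<phi> (v, x + z)) u + A (\<lambda>y. \<phi> (u, y)) (x + z) \<partial>p (u - s)))
           = - \<phi> (s, x)"
  shows "D = {f. \<exists>g. gen p f g} \<and> (\<forall>f\<in>D. gen p f (A f))"
proof -
  note setting = assms(1-4) assms(5)[rule_format]
  show ?thesis using gen_domain[OF setting] generator_domain_subset[OF setting] by blast
qed

end
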